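(* Let $A\in\mathrm{GL}(n,\mathbb{Z})$ be hyperbolic. If $C(A)=\langle A\rangle\times\langle J\rangle$, where the order of $J$ is $2^b$ for some $b\in\mathbb{N}$, and if \[ |\mathrm{Per}^p(A)\setminus\mathrm{Per}^1(A)|>|\mathrm{Per}^1(-I)| \] for some odd prime $p$, then $Z(f)$ is trivial, i.e. $Z(f)=\langle f\rangle$, for all $f\in\mathcal{U}_p(A)$.
   Context: A matrix $A\in\mathrm{GL}(n,\mathbb{Z})$ (integer entries, determinant $\pm1$) is identified with the automorphism it induces on $\mathbb{T}^n=\mathbb{R}^n/\mathbb{Z}^n$; $A$ is hyperbolic if it has no eigenvalue of modulus one. $I$ is the $n\times n$ identity. $C(A)=\{B\in\mathrm{GL}(n,\mathbb{Z}):BA=AB\}$, and $C(A)=\langle A\rangle\times\langle J\rangle$ means that $J\in C(A)$ and $C(A)$ is the internal direct product of the cyclic subgroups generated by $A$ and $J$. For a map $f$ of $\mathbb{T}^n$ and $k\in\mathbb{N}$, $\mathrm{Per}^k(f)=\{\theta: f^k(\theta)=\theta\}$. For $f\in\mathrm{Diff}^1(\mathbb{T}^n)$, $Z(f)=\{g\in\mathrm{Diff}^1(\mathbb{T}^n):fg=gf\}$ and $\langle f\rangle=\{f^k:k\in\mathbb{Z}\}$. By structural stability of Anosov diffeomorphisms, there is an open neighbourhood $\mathcal{U}(A)$ of $A$ in $\mathrm{Diff}^1(\mathbb{T}^n)$ ($C^1$ topology) such that every $f\in\mathcal{U}(A)$ is Anosov and there is a homeomorphism $h_f$ of $\mathbb{T}^n$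 (close to the identity) with $h_f f h_f^{-1}=A$; fix such $\mathcal{U}(A)$ and $h_f$. For $k\in\mathbb{N}$, $\mathcal{U}_k(A)$ denotes a (nonempty) open subset of $\mathcal{U}(A)\setminus\{A\}$ such that for every $f\in\mathcal{U}_k(A)$ any two distinct $k$-periodic orbits have different spectra: if $\theta,\theta'\in\mathrm{Per}^k(f)$ lie in distinct $f$-orbits, then $D_\theta f^k$ and $D_{\theta'}f^k$ have different spectra (in particular are not similar). *)

theory Defs
  imports
    "HOL-Analysis.Analysis"
    "HOL-Algebra.Multiplicative_Group"
    "HOL-Algebra.Generated_Groups"
    "HOL-Computational_Algebra.Primes"
begin

section \<open>The torus\<close>

definition lattice_rel :: "real ^ 'n \<Rightarrow> real ^ 'n \<Rightarrow> bool" where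
  "lattice_rel x y \<longleftrightarrow> (\<forall>i. x $ i - y $ i \<in> \<int>)"

lemma lattice_rel_sym: "lattice_rel x y \<Longrightarrow> lattice_rel y x"
  unfolding lattice_rel_def using Ints_minus by fastforce

lemma lattice_rel_trans: "lattice_rel x y \<Longrightarrow> lattice_rel y z \<Longrightarrow> lattice_rel x z"
  unfolding lattice_rel_def using Ints_add by (metis diff_add_cancel add_diff_eq)

lemma equivp_lattice_rel: "equivp lattice_rel"
  by (rule equivpI)
    (auto intro!: reflpI sympI transpI intro: lattice_rel_sym lattice_rel_trans simp: lattice_rel_def)

quotient_type 'n torus = "(real, 'n::finite) vec" / lattice_rel
  by (rule equivp_lattice_rel)

lift_definition torus_proj :: "real ^ 'n \<Rightarrow> 'n torus" is "\<lambda>x. x" .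

lemma torus_proj_eq_iff: "torus_proj x = torus_proj y \<longleftrightarrow> lattice_rel x y"
  by transfer simp

lemma torus_proj_surj: "\<exists>x. torus_proj x = \<theta>"
  by (rule exI[of _ "rep_torus \<theta>"])
    (metis Quotient3_abs_rep Quotient3_torus torus_proj.abs_eq)

lemma lattice_rel_shift:
  assumes "torus_proj y = torus_proj z"
  shows "torus_proj (x + (y - z)) = torus_proj x"
  using assms unfolding torus_proj_eq_iff lattice_rel_def by simp

text \<open>The flat metric: the quotient metric of the Euclidean metric.\<close>

instantiation torus :: (finite) metric_space
begin

definition dist_torus :: "'a torus \<Rightarrow> 'a torus \<Rightarrow> real" where
  "dist_torus \<theta> \<theta>' = Inf {dist x y | x y. torus_proj x = \<theta> \<and> torus_proj y = \<theta>'}"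

definition uniformity_torus :: "('a torus \<times> 'a torus) filter" where
  "uniformity_torus = (INF e\<in>{0 <..}. principal {(x, y). dist x y < e})"

definition open_torus :: "'a torus set \<Rightarrow> bool" where
  "open_torus U \<longleftrightarrow> (\<forall>x\<in>U. eventually (\<lambda>(x', y). x' = x \<longrightarrow> y \<in> U) uniformity)"

lemma dist_torus_le: "dist (torus_proj x) (torus_proj y) \<le> dist x y"
  unfolding dist_torus_def by (rule cInf_lower) (auto intro: bdd_belowI[of _ 0])

lemma dist_torus_less:
  assumes "dist \<theta> \<theta>' < (e::real)"
  obtains x y where "torus_proj x = \<theta>" "torus_proj y = \<theta>'" "dist x y < e"
proof -
  define S where "S = {dist x y | x y. torus_proj x = \<theta> \<and> torus_proj y = \<theta>'}"
  obtain x0 y0 where "torus_proj x0 = \<theta>" "torus_proj y0 = \<theta>'"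
    using torus_proj_surj by metis
  then have "dist x0 y0 \<in> S" unfolding S_def by (intro CollectI exI conjI) simp_all
  then have ne: "S \<noteq> {}" by (metis empty_iff)
  have less: "Inf S < e" using assms unfolding dist_torus_def S_def .
  obtain s where s: "s \<in> S" "s < e"
    using cInf_lessD[OF ne less] by (elim bexE)
  from s(1) obtain x y where "torus_proj x = \<theta>" "torus_proj y = \<theta>'" "s = dist x y"
    unfolding S_def by (elim CollectE exE conjE)
  with s(2) show thesis by (intro that) simp_all
qed

lemma dist_torus_eq_0D:
  assumes "dist \<theta> \<theta>' = (0::real)"
  shows "\<theta> = (\<theta>' :: 'a torus)"
proof (rule ccontr)
  obtain x0 y0 where x0: "torus_proj x0 = \<theta>" and y0: "torus_proj y0 = \<theta>'"
    using torus_proj_surj by metis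
  assume "\<theta> \<noteq> \<theta>'"
  then obtain i where i: "x0 $ i - y0 $ i \<notin> \<int>"
    using x0 y0 torus_proj_eq_iff lattice_rel_def by metis
  define t where "t = x0 $ i - y0 $ i"
  define e where "e = min (frac t) (1 - frac t)"
  have "e > 0" using i frac_lt_1[of t] frac_gt_0_iff[of t] unfolding e_def t_def by auto
  then obtain x y where xy: "torus_proj x = \<theta>" "torus_proj y = \<theta>'" "dist x y < e"
    using assms dist_torus_less[of \<theta> \<theta>' e] by auto
  have "x $ i - x0 $ i \<in> \<int>" "y $ i - y0 $ i \<in> \<int>"
    using xy x0 y0 torus_proj_eq_iff[of x x0] torus_proj_eq_iff[of y y0]
    unfolding lattice_rel_def by auto
  then have "(x $ i - x0 $ i) - (y $ i - y0 $ i) \<in> \<int>" by (rule Ints_diff)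
  then obtain m :: int where m: "x $ i - y $ i = t + of_int m"
    unfolding t_def by (elim Ints_cases) (auto simp: algebra_simps)
  have "\<bar>x $ i - y $ i\<bar> \<le> dist x y"
    using component_le_norm_cart[of "x - y" i] by (simp add: dist_norm)
  then have less: "\<bar>t + of_int m\<bar> < e" using xy m by simp
  have "t + of_int m = frac t + of_int (\<lfloor>t\<rfloor> + m)" by (simp add: frac_def)
  moreover have "\<lfloor>t\<rfloor> + m \<ge> 0 \<or> \<lfloor>t\<rfloor> + m \<le> -1" by linarith
  then have "real_of_int (\<lfloor>t\<rfloor> + m) \<ge> 0 \<or> real_of_int (\<lfloor>t\<rfloor> + m) \<le> -1" by linarith
  ultimately show False using less unfolding e_def by linarith
qed

instance
proof
  fix \<theta> \<theta>' \<theta>'' :: "'a torus"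
  obtain x0 y0 where x0: "torus_proj x0 = \<theta>" and y0: "torus_proj y0 = \<theta>'"
    using torus_proj_surj by metis
  have nonneg: "0 \<le> dist a b" for a b :: "'a torus"
  proof -
    obtain x y where "torus_proj x = a" "torus_proj y = b" using torus_proj_surj by metis
    then show ?thesis
      unfolding dist_torus_def by (intro cInf_greatest) auto
  qed
  show "dist \<theta> \<theta>' = 0 \<longleftrightarrow> \<theta> = \<theta>'"
    using dist_torus_eq_0D[of \<theta> \<theta>'] dist_torus_le[of x0 x0] x0 nonneg[of \<theta> \<theta>]
    by auto
  have commute: "dist a b = dist b a" for a b :: "'a torus"
  proof -
    have "{dist x y | x y. torus_proj x = a \<and> torus_proj y = b} =
          {dist x y | x y. torus_proj x = b \<and> torus_proj y = a}"
      using dist_commute by blast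
    then show ?thesis unfolding dist_torus_def by simp
  qed
  show "dist \<theta> \<theta>' \<le> dist \<theta> \<theta>'' + dist \<theta>' \<theta>''"
  proof (rule field_le_epsilon)
    fix e :: real assume e: "e > 0"
    obtain x z where xz: "torus_proj x = \<theta>" "torus_proj z = \<theta>''" "dist x z < dist \<theta> \<theta>'' + e / 2"
      using dist_torus_less[of \<theta> \<theta>'' "dist \<theta> \<theta>'' + e / 2"] e by auto
    obtain y w where yw: "torus_proj y = \<theta>'" "torus_proj w = \<theta>''" "dist y w < dist \<theta>' \<theta>'' + e / 2"
      using dist_torus_less[of \<theta>' \<theta>'' "dist \<theta>' \<theta>'' + e / 2"] e by auto
    have "torus_proj (y + (z - w)) = \<theta>'" using lattice_rel_shift[of z w y] xz yw by simp
    then have "dist \<theta> \<theta>' \<le> dist x (y + (z - w))" using dist_torus_le xz(1) by metis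
    also have "\<dots> \<le> dist x z + dist y w"
      using norm_triangle_ineq[of "x - z" "w - y"]
      by (simp add: dist_norm norm_minus_commute algebra_simps)
    finally show "dist \<theta> \<theta>' \<le> dist \<theta> \<theta>'' + dist \<theta>' \<theta>'' + e" using xz yw by linarith
  qed
qed (simp_all add: uniformity_torus_def open_torus_def)

end

section \<open>Diffeomorphisms of the torus\<close>

text \<open>
  Tangent spaces are identified with \<^typ>\<open>real ^ 'n\<close> through the covering projection, so the
  derivative of a torus map at a point is a real matrix: the derivative of a lift that is
  differentiable over that point.  Only differentiability of the lift \<^term>\<open>F\<close> at the one point
  \<^term>\<open>x\<close> is asked for (two lifts differ by a lattice-valued function, which is locally constant
  at \<^term>\<open>x\<close> when both are continuous there), so this is the chartwise derivative.
\<close>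

definition has_torus_deriv :: "('n::finite torus \<Rightarrow> 'n torus) \<Rightarrow> real ^ 'n ^ 'n \<Rightarrow> 'n torus \<Rightarrow> bool" where
  "has_torus_deriv f M \<theta> \<longleftrightarrow>
     (\<exists>F x. torus_proj x = \<theta> \<and> (\<forall>y. torus_proj (F y) = f (torus_proj y)) \<and>
            (F has_derivative (\<lambda>v. M *v v)) (at x))"

definition torus_deriv :: "('n::finite torus \<Rightarrow> 'n torus) \<Rightarrow> 'n torus \<Rightarrow> real ^ 'n ^ 'n" where
  "torus_deriv f \<theta> = (THE M. has_torus_deriv f M \<theta>)"

lemma has_torus_deriv_lift_at:
  assumes "has_torus_deriv f M \<theta>" "torus_proj x = \<theta>"
  obtains F where "\<And>y. torus_proj (F y) = f (torus_proj y)" "(F has_derivative (\<lambda>v. M *v v)) (at x)"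
proof -
  obtain F z where F: "torus_proj z = \<theta>" "\<And>y. torus_proj (F y) = f (torus_proj y)"
      "(F has_derivative (\<lambda>v. M *v v)) (at z)"
    using assms unfolding has_torus_deriv_def by blast
  have "((\<lambda>y. F (y + (z - x))) has_derivative (\<lambda>v. M *v v)) (at x)"
    by (rule has_derivative_compose[where g = F and g' = "\<lambda>v. M *v v" and f' = "\<lambda>v. v"])
      (auto intro!: derivative_eq_intros simp: F)
  moreover have "torus_proj (F (y + (z - x))) = f (torus_proj y)" for y
    using F(2) lattice_rel_shift[of z x y] assms F by simp
  ultimately show thesis by (rule that[rotated])
qed

lemma has_torus_deriv_unique:
  assumes "has_torus_deriv f M \<theta>" "has_torus_deriv f N \<theta>"
  shows "M = N"
proof -
  obtain x where x: "torus_proj x = \<theta>" using torus_proj_surj by blast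
  obtain F where F: "\<And>y. torus_proj (F y) = f (torus_proj y)" "(F has_derivative (\<lambda>v. M *v v)) (at x)"
    using has_torus_deriv_lift_at[OF assms(1) x] by blast
  obtain G where G: "\<And>y. torus_proj (G y) = f (torus_proj y)" "(G has_derivative (\<lambda>v. N *v v)) (at x)"
    using has_torus_deriv_lift_at[OF assms(2) x] by blast
  define H where "H = (\<lambda>y. F y - G y)"
  have H: "H y $ i \<in> \<int>" for y i
    using F(1)[of y] G(1)[of y] torus_proj_eq_iff[of "F y" "G y"]
    unfolding H_def lattice_rel_def by simp
  have dH: "(H has_derivative (\<lambda>v. M *v v - N *v v)) (at x)"
    unfolding H_def by (rule has_derivative_diff[OF F(2) G(2)])
  then have "isCont H x" by (rule has_derivative_continuous)
  then have "\<forall>\<^sub>F y in nhds x. dist (H y) (H x) < 1"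
    unfolding isCont_def using tendsto_at_iff_tendsto_nhds tendstoD[of H "H x" "nhds x" 1]
    by fastforce
  then have "\<forall>\<^sub>F y in nhds x. H y = H x"
  proof (rule eventually_mono)
    fix y assume y: "dist (H y) (H x) < 1"
    show "H y = H x"
    proof (rule vec_eq_iff[THEN iffD2], rule allI)
      fix i
      have "\<bar>H y $ i - H x $ i\<bar> < 1"
        using component_le_norm_cart[of "H y - H x" i] y by (simp add: dist_norm)
      moreover have "H y $ i - H x $ i \<in> \<int>" using H Ints_diff by blast
      ultimately show "H y $ i = H x $ i" using Ints_nonzero_abs_less1 by fastforce
    qed
  qed
  then have "\<forall>\<^sub>F y in at x. H x = H y"
    unfolding eventually_at_filter by (rule eventually_mono) simp
  with has_derivative_const have "(H has_derivative (\<lambda>v. 0)) (at x)"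
    by (rule has_derivative_transform_eventually) simp_all
  then have "(\<lambda>v. M *v v - N *v v) = (\<lambda>v. 0)" using dH has_derivative_unique by blast
  then have "M *v v = N *v v" for v by (metis eq_iff_diff_eq_0)
  then show ?thesis by (simp add: matrix_eq)
qed

lemma torus_deriv_eq: "has_torus_deriv f M \<theta> \<Longrightarrow> torus_deriv f \<theta> = M"
  unfolding torus_deriv_def by (rule the_equality) (auto dest: has_torus_deriv_unique)

definition torus_C1 :: "('n::finite torus \<Rightarrow> 'n torus) \<Rightarrow> bool" where
  "torus_C1 f \<longleftrightarrow> (\<forall>\<theta>. \<exists>M. has_torus_deriv f M \<theta>) \<and> continuous_on UNIV (torus_deriv f)"

definition Diff1 :: "('n::finite torus \<Rightarrow> 'n torus) set" where
  "Diff1 = {f. bij f \<and> torus_C1 f \<and> torus_C1 (inv_into UNIV f)}"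

definition Diff1_group :: "('n::finite torus \<Rightarrow> 'n torus) monoid" where
  "Diff1_group = \<lparr>carrier = Diff1, mult = (\<circ>), one = id\<rparr>"

lemma has_torus_deriv_continuous:
  assumes "has_torus_deriv f M \<theta>"
  shows "isCont f \<theta>"
proof -
  obtain F x where F: "torus_proj x = \<theta>" "\<And>y. torus_proj (F y) = f (torus_proj y)"
      "(F has_derivative (\<lambda>v. M *v v)) (at x)"
    using assms unfolding has_torus_deriv_def by blast
  have "isCont F x" using F(3) by (rule has_derivative_continuous)
  show ?thesis unfolding continuous_at_eps_delta
  proof (intro allI impI)
    fix e :: real assume "e > 0"
    then obtain d where d: "d > 0" "\<And>y. dist y x < d \<Longrightarrow> dist (F y) (F x) < e"
      using \<open>isCont F x\<close> unfolding continuous_at_eps_delta by blast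
    have "dist (f \<theta>') (f \<theta>) < e" if less: "dist \<theta>' \<theta> < d" for \<theta>'
    proof -
      obtain y z where yz: "torus_proj y = \<theta>'" "torus_proj z = \<theta>" "dist y z < d"
        by (rule dist_torus_less[OF less])
      define y' where "y' = y + (x - z)"
      have "torus_proj y' = \<theta>'" unfolding y'_def using lattice_rel_shift[of x z y] yz F by simp
      moreover have "dist y' x < d" using yz unfolding y'_def by (simp add: dist_norm algebra_simps)
      ultimately have "dist (F y') (F x) < e" "torus_proj (F y') = f \<theta>'" "torus_proj (F x) = f \<theta>"
        using d F by auto
      then show ?thesis using dist_torus_le[of "F y'" "F x"] by simp
    qed
    then show "\<exists>d>0. \<forall>\<theta>'. dist \<theta>' \<theta> < d \<longrightarrow> dist (f \<theta>') (f \<theta>) < e" using d(1) by blast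
  qed
qed

lemma has_torus_deriv_compose:
  assumes f: "has_torus_deriv f M \<theta>" and g: "has_torus_deriv g N (f \<theta>)"
  shows "has_torus_deriv (g \<circ> f) (N ** M) \<theta>"
proof -
  obtain F x where F: "torus_proj x = \<theta>" "\<And>y. torus_proj (F y) = f (torus_proj y)"
      "(F has_derivative (\<lambda>v. M *v v)) (at x)"
    using f unfolding has_torus_deriv_def by blast
  obtain G where G: "\<And>y. torus_proj (G y) = g (torus_proj y)"
      "(G has_derivative (\<lambda>v. N *v v)) (at (F x))"
    using has_torus_deriv_lift_at[OF g, of "F x"] F by auto
  have "((\<lambda>y. G (F y)) has_derivative (\<lambda>v. (N ** M) *v v)) (at x)"
    using has_derivative_compose[OF F(3) G(2)] by (simp add: matrix_vector_mul_assoc)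
  then show ?thesis unfolding has_torus_deriv_def using F G by (metis comp_apply)
qed

lemma torus_C1_compose:
  assumes f: "torus_C1 f" and g: "torus_C1 g"
  shows "torus_C1 (g \<circ> f)"
proof -
  have df: "has_torus_deriv f (torus_deriv f \<theta>) \<theta>" for \<theta>
    using f torus_deriv_eq unfolding torus_C1_def by metis
  have dg: "has_torus_deriv g (torus_deriv g \<theta>) \<theta>" for \<theta>
    using g torus_deriv_eq unfolding torus_C1_def by metis
  have d: "has_torus_deriv (g \<circ> f) (torus_deriv g (f \<theta>) ** torus_deriv f \<theta>) \<theta>" for \<theta>
    by (rule has_torus_deriv_compose[OF df dg])
  have cf: "continuous_on UNIV f"
    using df has_torus_deriv_continuous continuous_at_imp_continuous_on by blast
  have "continuous_on UNIV (\<lambda>\<theta>. torus_deriv g (f \<theta>))"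
    using continuous_on_compose2[OF _ cf, of UNIV "torus_deriv g"] g unfolding torus_C1_def by auto
  moreover have "continuous_on UNIV (torus_deriv f)" using f unfolding torus_C1_def by auto
  ultimately have "continuous_on UNIV (\<lambda>\<theta>. torus_deriv g (f \<theta>) ** torus_deriv f \<theta>)"
    unfolding matrix_matrix_mult_def by (intro continuous_intros)
  moreover have "torus_deriv (g \<circ> f) = (\<lambda>\<theta>. torus_deriv g (f \<theta>) ** torus_deriv f \<theta>)"
    using torus_deriv_eq[OF d] by auto
  ultimately show ?thesis using d unfolding torus_C1_def by auto
qed

lemma torus_C1_id: "torus_C1 (id :: 'n::finite torus \<Rightarrow> 'n torus)"
proof -
  have d: "has_torus_deriv id (mat 1) \<theta>" for \<theta> :: "'n torus"
  proof -
    obtain x where "torus_proj x = \<theta>" using torus_proj_surj by blast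
    then show ?thesis unfolding has_torus_deriv_def
      by (intro exI[of _ "\<lambda>y. y"] exI[of _ x]) (auto intro!: derivative_eq_intros)
  qed
  then have "torus_deriv id = (\<lambda>\<theta> :: 'n torus. mat 1)" using torus_deriv_eq by blast
  then show ?thesis using d unfolding torus_C1_def by auto
qed

lemma group_Diff1: "group (Diff1_group :: ('n::finite torus \<Rightarrow> 'n torus) monoid)"
proof (rule groupI)
  show "f \<otimes>\<^bsub>Diff1_group\<^esub> g \<in> carrier Diff1_group"
    if "f \<in> carrier Diff1_group" "g \<in> carrier Diff1_group" for f g :: "'n torus \<Rightarrow> 'n torus"
    using that
    by (auto simp: Diff1_group_def Diff1_def o_inv_distrib torus_C1_compose bij_comp)
  show "\<exists>g\<in>carrier Diff1_group. g \<otimes>\<^bsub>Diff1_group\<^esub> f = \<one>\<^bsub>Diff1_group\<^esub>"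
    if "f \<in> carrier Diff1_group" for f :: "'n torus \<Rightarrow> 'n torus"
    using that
    by (intro bexI[of _ "inv_into UNIV f"])
      (auto simp: Diff1_group_def Diff1_def bij_imp_bij_inv inv_inv_eq bij_is_inj)
qed (auto simp: Diff1_group_def Diff1_def torus_C1_id comp_assoc)

text \<open>Since the torus is compact, uniform closeness of values and derivatives gives the
  \<open>C\<^sup>1\<close> topology.\<close>

definition C1_close :: "real \<Rightarrow> ('n::finite torus \<Rightarrow> 'n torus) \<Rightarrow> ('n torus \<Rightarrow> 'n torus) \<Rightarrow> bool" where
  "C1_close e f g \<longleftrightarrow>
     (\<forall>\<theta>. dist (f \<theta>) (g \<theta>) < e \<and> dist (torus_deriv f \<theta>) (torus_deriv g \<theta>) < e)"

definition C1_topology :: "('n::finite torus \<Rightarrow> 'n torus) topology" where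
  "C1_topology = topology (\<lambda>U. U \<subseteq> Diff1 \<and> (\<forall>f\<in>U. \<exists>e>0. \<forall>g\<in>Diff1. C1_close e f g \<longrightarrow> g \<in> U))"

lemma openin_C1_topology:
  fixes U :: "('n::finite torus \<Rightarrow> 'n torus) set"
  shows "openin C1_topology U \<longleftrightarrow>
     U \<subseteq> Diff1 \<and> (\<forall>f\<in>U. \<exists>e>0. \<forall>g\<in>Diff1. C1_close e f g \<longrightarrow> g \<in> U)"
proof -
  have mono: "C1_close e f g" if "C1_close d f g" "d \<le> e" for d e and f g :: "'n torus \<Rightarrow> 'n torus"
    using that unfolding C1_close_def by (meson less_le_trans)
  define opn :: "('n torus \<Rightarrow> 'n torus) set \<Rightarrow> bool" where
    "opn = (\<lambda>U. U \<subseteq> Diff1 \<and> (\<forall>f\<in>U. \<exists>e>0. \<forall>g\<in>Diff1. C1_close e f g \<longrightarrow> g \<in> U))"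
  have "istopology opn"
    unfolding istopology_def opn_def
  proof (intro conjI allI impI)
    fix S T :: "('n torus \<Rightarrow> 'n torus) set"
    assume S: "S \<subseteq> Diff1 \<and> (\<forall>f\<in>S. \<exists>e>0. \<forall>g\<in>Diff1. C1_close e f g \<longrightarrow> g \<in> S)"
      and T: "T \<subseteq> Diff1 \<and> (\<forall>f\<in>T. \<exists>e>0. \<forall>g\<in>Diff1. C1_close e f g \<longrightarrow> g \<in> T)"
    show "S \<inter> T \<subseteq> Diff1" using S by blast
    show "\<forall>f\<in>S \<inter> T. \<exists>e>0. \<forall>g\<in>Diff1. C1_close e f g \<longrightarrow> g \<in> S \<inter> T"
    proof
      fix f assume "f \<in> S \<inter> T"
      then obtain d e where "d > 0" "e > 0" "\<forall>g\<in>Diff1. C1_close d f g \<longrightarrow> g \<in> S"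
          "\<forall>g\<in>Diff1. C1_close e f g \<longrightarrow> g \<in> T"
        using S T by blast
      then show "\<exists>e>0. \<forall>g\<in>Diff1. C1_close e f g \<longrightarrow> g \<in> S \<inter> T"
        using mono by (intro exI[of _ "min d e"]) (meson IntI min.cobounded1 min.cobounded2 min_less_iff_conj)
    qed
  next
    fix K :: "('n torus \<Rightarrow> 'n torus) set set"
    assume K: "\<forall>S\<in>K. S \<subseteq> Diff1 \<and> (\<forall>f\<in>S. \<exists>e>0. \<forall>g\<in>Diff1. C1_close e f g \<longrightarrow> g \<in> S)"
    then show "\<Union> K \<subseteq> Diff1" by (intro Union_least) simp
    show "\<forall>f\<in>\<Union> K. \<exists>e>0. \<forall>g\<in>Diff1. C1_close e f g \<longrightarrow> g \<in> \<Union> K"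
    proof
      fix f assume "f \<in> \<Union> K"
      then obtain S where S: "S \<in> K" "f \<in> S" by (elim UnionE)
      then obtain e where "e > 0" "\<forall>g\<in>Diff1. C1_close e f g \<longrightarrow> g \<in> S"
        using K by meson
      with S(1) show "\<exists>e>0. \<forall>g\<in>Diff1. C1_close e f g \<longrightarrow> g \<in> \<Union> K"
        by (intro exI[of _ e]) (auto simp: C1_close_def)
    qed
  qed
  then have "openin (topology opn) = opn" by (rule topology_inverse')
  then have "openin (topology opn) U \<longleftrightarrow> opn U" by (rule fun_cong)
  then show ?thesis unfolding C1_topology_def opn_def .
qed

text \<open>Uniform contraction of \<open>Es\<close> in forward time and of \<open>Eu\<close> in backward time; continuity of
  the splitting is a consequence.\<close>

definition anosov :: "('n::finite torus \<Rightarrow> 'n torus) \<Rightarrow> bool" where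
  "anosov f \<longleftrightarrow> f \<in> Diff1 \<and>
     (\<exists>(Es :: 'n torus \<Rightarrow> (real ^ 'n) set) Eu c l. c > 0 \<and> 0 < l \<and> l < 1 \<and>
        (\<forall>\<theta>. subspace (Es \<theta>) \<and> subspace (Eu \<theta>) \<and>
             Es \<theta> \<inter> Eu \<theta> = {0} \<and> {v + w | v w. v \<in> Es \<theta> \<and> w \<in> Eu \<theta>} = UNIV \<and>
             (\<lambda>v. torus_deriv f \<theta> *v v) ` Es \<theta> = Es (f \<theta>) \<and>
             (\<lambda>v. torus_deriv f \<theta> *v v) ` Eu \<theta> = Eu (f \<theta>) \<and>
             (\<forall>v\<in>Es \<theta>. \<forall>k. norm (torus_deriv (f ^^ k) \<theta> *v v) \<le> c * l ^ k * norm v) \<and>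
             (\<forall>v\<in>Eu \<theta>. \<forall>k. norm (torus_deriv (inv_into UNIV f ^^ k) \<theta> *v v) \<le> c * l ^ k * norm v)))"

section \<open>Periodic points and spectra\<close>

definition Per :: "nat \<Rightarrow> ('a \<Rightarrow> 'a) \<Rightarrow> 'a set" where
  "Per k f = {\<theta>. (f ^^ k) \<theta> = \<theta>}"

definition torus_orbit :: "('n::finite torus \<Rightarrow> 'n torus) \<Rightarrow> 'n torus \<Rightarrow> 'n torus set" where
  "torus_orbit f \<theta> = {(f [^]\<^bsub>Diff1_group\<^esub> k) \<theta> | k :: int. True}"

text \<open>The spectrum is the set of complex eigenvalues, without multiplicities.\<close>

definition mat_spectrum :: "complex ^ 'n ^ 'n \<Rightarrow> complex set" where
  "mat_spectrum M = {\<mu>. \<exists>v. v \<noteq> 0 \<and> M *v v = \<mu> *s v}"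

definition distinct_periodic_spectra :: "nat \<Rightarrow> ('n::finite torus \<Rightarrow> 'n torus) \<Rightarrow> bool" where
  "distinct_periodic_spectra k f \<longleftrightarrow>
     (\<forall>\<theta>\<in>Per k f. \<forall>\<theta>'\<in>Per k f. torus_orbit f \<theta> \<noteq> torus_orbit f \<theta>' \<longrightarrow>
        mat_spectrum (map_matrix of_real (torus_deriv (f ^^ k) \<theta>)) \<noteq>
        mat_spectrum (map_matrix of_real (torus_deriv (f ^^ k) \<theta>')))"

section \<open>Integer matrices and centralizers\<close>

definition GLZ :: "(int ^ 'n ^ 'n) monoid" where
  "GLZ = \<lparr>carrier = {A. det A = 1 \<or> det A = -1}, mult = (**), one = mat 1\<rparr>"

lemma int_matrix_inverse_exists:
  fixes A :: "int ^ 'n ^ 'n"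
  assumes "det A = 1 \<or> det A = -1"
  shows "\<exists>B. (det B = 1 \<or> det B = -1) \<and> B ** A = mat 1"
proof -
  define r :: "int ^ 'n ^ 'n \<Rightarrow> real ^ 'n ^ 'n" where "r = map_matrix of_int"
  have det_r: "det (r M) = of_int (det M)" for M by (simp add: r_def det_def)
  have mult_r: "r (M ** N) = r M ** r N" for M N
    by (simp add: r_def vec_eq_iff matrix_matrix_mult_def)
  have r_one: "r (mat 1) = mat 1" by (simp add: r_def vec_eq_iff mat_def)
  have inj_r: "M = N" if "r M = r N" for M N
    using that by (simp add: r_def vec_eq_iff)
  have "det (r A) \<noteq> 0" using assms by (auto simp: det_r)
  then obtain R where R: "r A ** R = mat 1" "R ** r A = mat 1"
    using invertible_det_nz[of "r A"] unfolding invertible_def by blast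
  have "R $ k $ j \<in> \<int>" for k j
  proof -
    have "r A *v (R *v axis j 1) = axis j 1" by (simp add: matrix_vector_mul_assoc R)
    then have "R $ k $ j * det (r A) =
        det (\<chi> a c. if c = k then (axis j 1 :: real ^ 'n) $ a else r A $ a $ c)"
      using cramer_lemma[where A = "r A" and k = k and x = "R *v axis j 1"]
      by (simp only:) (simp add: matrix_vector_mult_basis column_def)
    also have "\<dots> = det (r (\<chi> a c. if c = k then (if a = j then 1 else 0) else A $ a $ c))"
      by (rule arg_cong[where f = det]) (simp add: r_def vec_eq_iff axis_def)
    also have "\<dots> \<in> \<int>" unfolding det_r by simp
    finally have "R $ k $ j * det (r A) \<in> \<int>" .
    then show ?thesis using assms by (auto simp: det_r)
  qed
  then have R_eq: "R = r (\<chi> k j. \<lfloor>R $ k $ j\<rfloor>)"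
    by (simp add: r_def vec_eq_iff)
  define B where "B = (\<chi> k j. \<lfloor>R $ k $ j\<rfloor>)"
  have BA: "B ** A = mat 1"
    by (rule inj_r) (use R R_eq in \<open>simp add: mult_r r_one B_def\<close>)
  then have "det B * det A = 1" by (metis det_mul det_I)
  then have "det B = 1 \<or> det B = -1" using zmult_eq_1_iff by blast
  with BA show ?thesis by blast
qed

lemma group_GLZ: "group (GLZ :: (int ^ 'n ^ 'n) monoid)"
proof (rule groupI)
  show "\<exists>B\<in>carrier GLZ. B \<otimes>\<^bsub>GLZ\<^esub> A = \<one>\<^bsub>GLZ\<^esub>"
    if "A \<in> carrier GLZ" for A :: "int ^ 'n ^ 'n"
    using that int_matrix_inverse_exists[of A] by (auto simp: GLZ_def)
qed (auto simp: GLZ_def det_mul matrix_mul_assoc)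

definition hyperbolic :: "int ^ 'n ^ 'n \<Rightarrow> bool" where
  "hyperbolic A \<longleftrightarrow> (\<forall>\<mu>\<in>mat_spectrum (map_matrix of_int A). cmod \<mu> \<noteq> 1)"

lift_definition torus_aut :: "int ^ 'n ^ 'n \<Rightarrow> 'n::finite torus \<Rightarrow> 'n torus" is
  "\<lambda>A x. map_matrix of_int A *v x"
proof -
  fix A :: "int ^ 'n ^ 'n" and x y :: "real ^ 'n"
  assume xy: "lattice_rel x y"
  show "lattice_rel (map_matrix of_int A *v x) (map_matrix of_int A *v y)"
    unfolding lattice_rel_def
  proof
    fix i
    have "(map_matrix of_int A *v x) $ i - (map_matrix of_int A *v y) $ i =
        (\<Sum>j\<in>UNIV. of_int (A $ i $ j) * (x $ j - y $ j))"
      by (simp add: matrix_vector_mult_def sum_subtractf right_diff_distrib)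
    also have "\<dots> \<in> \<int>"
      using xy by (intro Ints_sum Ints_mult) (auto simp: lattice_rel_def)
    finally show "(map_matrix of_int A *v x) $ i - (map_matrix of_int A *v y) $ i \<in> \<int>" .
  qed
qed

definition centralizer :: "('a, 'b) monoid_scheme \<Rightarrow> 'a \<Rightarrow> 'a set" where
  "centralizer G x = {y \<in> carrier G. y \<otimes>\<^bsub>G\<^esub> x = x \<otimes>\<^bsub>G\<^esub> y}"

abbreviation centralizer_group :: "('a, 'b) monoid_scheme \<Rightarrow> 'a \<Rightarrow> ('a, 'b) monoid_scheme" where
  "centralizer_group G x \<equiv> G\<lparr>carrier := centralizer G x\<rparr>"

definition internal_direct_product :: "('a, 'b) monoid_scheme \<Rightarrow> 'a set \<Rightarrow> 'a set \<Rightarrow> bool" where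
  "internal_direct_product G H K \<longleftrightarrow>
     H \<lhd> G \<and> K \<lhd> G \<and> H \<inter> K = {\<one>\<^bsub>G\<^esub>} \<and> H <#>\<^bsub>G\<^esub> K = carrier G"

end

theory Submission
  imports Defs "HOL-Computational_Algebra.Fundamental_Theorem_Algebra"
begin

text \<open>
  Let \<open>g\<close> commute with \<open>f\<close>. The derivative of \<open>g\<close> conjugates the derivatives of \<open>f\<^sup>p\<close> at \<open>\<theta>\<close> and
  at \<open>g \<theta>\<close>, so by the hypothesis on spectra \<open>g\<close> maps each orbit of \<open>p\<close>-periodic points to itself.
  Conjugating by \<open>h f\<close> gives a homeomorphism that commutes with \<open>A\<close> and fixes \<open>0\<close>; hyperbolicity
  forces it to be linear, say \<open>B = A\<^sup>i D\<close> with \<open>D\<close> in \<open>\<langle>J\<rangle>\<close>. On an orbit whose length divides the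
  odd number \<open>p\<close>, \<open>D\<close> acts like a power of \<open>A\<close> and has 2-power order, hence acts trivially. If
  \<open>D\<close> were nontrivial, then \<open>-1\<close> would be a power of \<open>D\<close> and would fix all \<open>p\<close>-periodic points of
  \<open>A\<close>, contrary to the count.
\<close>

section \<open>Bounded orbits of hyperbolic matrices\<close>

text \<open>The vector \<open>p(M) v\<close>, evaluated by Horner's scheme so that no powers of the
  matrix are formed.\<close>

definition poly_action :: "complex ^ 'n ^ 'n \<Rightarrow> complex ^ 'n \<Rightarrow> complex poly \<Rightarrow> complex ^ 'n" where
  "poly_action M v p = fold_coeffs (\<lambda>a w. a *s v + M *v w) p 0"

lemma poly_action_0 [simp]: "poly_action M v 0 = 0"
  by (simp add: poly_action_def)

lemma poly_action_pCons [simp]: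
  "poly_action M v (pCons a p) = a *s v + M *v poly_action M v p"
  by (cases "a = 0"; cases "p = 0") (simp_all add: poly_action_def)

lemma poly_action_add: "poly_action M v (p + q) = poly_action M v p + poly_action M v q"
  by (induction p q rule: poly_induct2)
    (simp_all add: vec.scale_left_distrib matrix_vector_right_distrib)

lemma poly_action_smult: "poly_action M v (Polynomial.smult c p) = c *s poly_action M v p"
  by (induction p)
    (simp_all add: vec.scale_right_distrib matrix_vector_mult_scaleR vec.scale)

lemma poly_action_sum: "poly_action M v (sum f S) = (\<Sum>i\<in>S. poly_action M v (f i))"
  by (induction S rule: infinite_finite_induct) (simp_all add: poly_action_add)

lemma poly_action_monom: "poly_action M v (Polynomial.monom c i) = c *s (((*v) M) ^^ i) v"
  by (induction i) (simp_all add: Polynomial.monom_0 Polynomial.monom_Suc vec.scale)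

text \<open>The iterates of \<open>v\<close> lie in a finite-dimensional space; a linear relation
  among them is a polynomial in \<open>M\<close> that kills \<open>v\<close>.\<close>

lemma exists_annihilating_poly:
  fixes M :: "complex ^ 'n ^ 'n"
  shows "\<exists>p. p \<noteq> 0 \<and> poly_action M v p = 0"
proof -
  define \<phi> where "\<phi> i = (((*v) M) ^^ i) v" for i
  show ?thesis
  proof (cases "inj \<phi>")
    \<comment> \<open>Linear dependence speaks of a set of vectors and overlooks repetitions. A
      repeated iterate is therefore treated apart, by the polynomial
      \<open>X^i - X^j\<close>.\<close>
    case False
    then obtain i j where ij: "i \<noteq> j" "\<phi> i = \<phi> j"
      unfolding inj_def by blast
    have "Polynomial.coeff (Polynomial.monom 1 i + Polynomial.monom (-1) j :: complex poly) i = 1"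
      using ij by simp
    then have "Polynomial.monom 1 i + Polynomial.monom (-1) j \<noteq> (0 :: complex poly)"
      by (metis Polynomial.coeff_0 zero_neq_one)
    moreover have "poly_action M v (Polynomial.monom 1 i + Polynomial.monom (-1) j) = 0"
      using ij by (simp add: poly_action_add poly_action_monom flip: \<phi>_def)
    ultimately show ?thesis by blast
  next
    case True
    then have "infinite (range \<phi>)" by (rule range_inj_infinite)
    then have "vec.dependent (range \<phi>)" using vec.finiteI_independent by blast
    then obtain S u w where S: "finite S" "S \<subseteq> range \<phi>" "(\<Sum>x\<in>S. u x *s x) = 0" "w \<in> S" "u w \<noteq> 0"
      unfolding vec.dependent_explicit by blast
    \<comment> \<open>The exponents of the iterates in \<open>S\<close>. As \<open>\<phi>\<close> is
      injective, each exponent stands for one vector, so the coefficients of the relation become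
      those of \<open>p\<close>.\<close>
    define T where "T = inv_into UNIV \<phi> ` S"
    have bij: "bij_betw (inv_into UNIV \<phi>) S T"
      unfolding T_def by (rule inj_on_imp_bij_betw) (use S(2) in \<open>auto intro: inj_on_inv_into\<close>)
    have inv: "\<phi> (inv_into UNIV \<phi> x) = x" if "x \<in> S" for x using that S(2) f_inv_into_f[of x \<phi> UNIV] by blast
    define p where "p = (\<Sum>i\<in>T. Polynomial.monom (u (\<phi> i)) i)"
    have "poly_action M v p = (\<Sum>i\<in>T. u (\<phi> i) *s \<phi> i)"
      by (simp add: p_def poly_action_sum poly_action_monom \<phi>_def)
    also have "\<dots> = (\<Sum>x\<in>S. u x *s x)"
      using sum.reindex_bij_betw[OF bij, of "\<lambda>i. u (\<phi> i) *s \<phi> i"] inv by simp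
    finally have "poly_action M v p = 0" using S by simp
    moreover have "Polynomial.coeff p (inv_into UNIV \<phi> w) = u w"
      using S(1,4) inv by (simp add: p_def Polynomial.coeff_sum T_def)
    then have "p \<noteq> 0" using S(5) by auto
    ultimately show ?thesis by blast
  qed
qed

text \<open>Induction on the degree of a polynomial that kills \<open>v\<close>: split off a root
  \<open>\<mu>\<close> and call the cofactor \<open>r\<close>. Either \<open>r\<close> already kills
  \<open>v\<close>, or \<open>r(M) v\<close> is an eigenvector for \<open>\<mu>\<close>. Invariance
  keeps all these vectors in \<open>V\<close>.\<close>

lemma eigenvector_in_invariant_subspace:
  fixes M :: "complex ^ 'n ^ 'n"
  assumes V: "vec.subspace V" "\<And>x. x \<in> V \<Longrightarrow> M *v x \<in> V"
    and v: "v \<in> V" "v \<noteq> 0"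
  obtains w \<mu> where "w \<in> V" "w \<noteq> 0" "M *v w = \<mu> *s w"
proof -
  have in_V: "poly_action M v p \<in> V" for p
    by (induction p) (auto simp: V v vec.subspace_0 vec.subspace_add vec.subspace_scale)
  have "\<exists>w \<mu>. w \<in> V \<and> w \<noteq> 0 \<and> M *v w = \<mu> *s w" if "p \<noteq> 0" "poly_action M v p = 0" for p
    using that
  proof (induction "Polynomial.degree p" arbitrary: p)
    case 0
    then obtain c where "p = [:c:]" by (metis degree_eq_zeroE)
    then show ?case using 0 v by auto
  next
    case (Suc d)
    then have "\<not> constant (poly p)"
      by (metis constant_degree nat.distinct(1))
    then obtain \<mu> where "poly p \<mu> = 0" using fundamental_theorem_of_algebra by blast
    then obtain r where r: "p = [:-\<mu>, 1:] * r" by (metis poly_eq_0_iff_dvd dvdE)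
    then have r0: "r \<noteq> 0" using Suc by auto
    have "Polynomial.degree p = Suc (Polynomial.degree r)"
      using r r0 by (simp add: degree_mult_eq del: mult_pCons_left)
    then have deg: "d = Polynomial.degree r" using Suc by simp
    \<comment> \<open>\<open>pCons 0\<close> is multiplication by the variable, which acts as
      \<open>M\<close>.\<close>
    have "p = Polynomial.smult (- \<mu>) r + pCons 0 r" unfolding r by simp
    then have "poly_action M v p = - \<mu> *s poly_action M v r + M *v poly_action M v r"
      by (simp only: poly_action_add poly_action_smult) simp
    then have eig: "M *v poly_action M v r = \<mu> *s poly_action M v r"
      using Suc.prems by simp
    show ?case
    proof (cases "poly_action M v r = 0")
      case True
      then show ?thesis using Suc.hyps(1)[OF deg r0] by blast
    next
      case False
      then show ?thesis using eig in_V by blast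
    qed
  qed
  then show thesis using exists_annihilating_poly[of M v] that by blast
qed

text \<open>The vectors with bounded forward and backward orbit form an invariant subspace. If it
  were nonzero it would contain an eigenvector, whose eigenvalue could have modulus neither above
  nor below one.\<close>

lemma matrix_funpow_bounded_imp_zero:
  fixes M N :: "complex ^ 'n ^ 'n"
  assumes MN: "M ** N = mat 1" "N ** M = mat 1"
    and hyp: "\<forall>\<mu>\<in>mat_spectrum M. cmod \<mu> \<noteq> 1"
    and v: "\<And>k. norm ((((*v) M) ^^ k) v) \<le> K" "\<And>k. norm ((((*v) N) ^^ k) v) \<le> K"
  shows "v = 0"
proof (rule ccontr)
  assume "v \<noteq> 0"
  define bdd where "bdd L x \<longleftrightarrow> (\<forall>k. norm ((((*v) M) ^^ k) x) \<le> L \<and> norm ((((*v) N) ^^ k) x) \<le> L)" for L x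
  define V where "V = {x. \<exists>L. bdd L x}"
  have pow_add: "(((*v) R) ^^ k) (x + y) = (((*v) R) ^^ k) x + (((*v) R) ^^ k) y" for R :: "complex ^ 'n ^ 'n" and k x y
    by (induction k) (simp_all add: matrix_vector_right_distrib)
  have pow_scale: "(((*v) R) ^^ k) (c *s x) = c *s (((*v) R) ^^ k) x" for R :: "complex ^ 'n ^ 'n" and k c x
    by (induction k) (simp_all add: vec.scale)
  have norm_scale: "norm (c *s x) = cmod c * norm x" for c and x :: "complex ^ 'n"
    by (simp add: norm_vec_def norm_mult L2_set_right_distrib)
  have sub: "vec.subspace V"
  proof (rule vec.subspaceI)
    have "bdd 0 0" unfolding bdd_def using pow_scale[where c = 0] by simp
    then show "0 \<in> V" unfolding V_def by blast
  next
    fix x y assume "x \<in> V" "y \<in> V"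
    then obtain K L where "bdd K x" "bdd L y" unfolding V_def by blast
    then have "bdd (K + L) (x + y)"
      unfolding bdd_def pow_add by (meson norm_triangle_mono)
    then show "x + y \<in> V" unfolding V_def by blast
  next
    fix c x assume "x \<in> V"
    then obtain K where "bdd K x" unfolding V_def by blast
    then have "bdd (cmod c * K) (c *s x)"
      unfolding bdd_def pow_scale norm_scale by (simp add: mult_left_mono)
    then show "c *s x \<in> V" unfolding V_def by blast
  qed
  have inv: "M *v x \<in> V" if x: "x \<in> V" for x
  proof -
    obtain L where L: "bdd L x" using x unfolding V_def by blast
    have "bdd L (M *v x)" unfolding bdd_def
    proof (intro allI conjI)
      fix k
      show "norm ((((*v) M) ^^ k) (M *v x)) \<le> L"
        using L unfolding bdd_def by (metis comp_apply funpow_Suc_right)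
      show "norm ((((*v) N) ^^ k) (M *v x)) \<le> L"
      \<comment> \<open>Backward iterates of \<open>M *v x\<close> are those of \<open>x\<close>
        delayed by one; for \<open>k = 0\<close> the vector is the first forward iterate of
        \<open>x\<close>.\<close>
      proof (cases k)
        case 0
        then show ?thesis using L unfolding bdd_def by (metis funpow_0 funpow_simps_right(2) o_apply)
      next
        case (Suc j)
        then have "(((*v) N) ^^ k) (M *v x) = (((*v) N) ^^ j) x"
          by (simp add: funpow_Suc_right matrix_vector_mul_assoc MN del: funpow.simps)
        then show ?thesis using L unfolding bdd_def by simp
      qed
    qed
    then show ?thesis unfolding V_def by blast
  qed
  have "v \<in> V" using v unfolding V_def bdd_def by blast
  then obtain w \<mu> where w: "w \<in> V" "w \<noteq> 0" "M *v w = \<mu> *s w"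
    using eigenvector_in_invariant_subspace[OF sub inv _ \<open>v \<noteq> 0\<close>] by blast
  obtain L where L: "bdd L w" using w unfolding V_def by blast
  have "w = N *v (M *v w)" by (simp add: matrix_vector_mul_assoc MN)
  then have wN: "w = \<mu> *s (N *v w)" using w(3) by (simp add: vec.scale)
  then have "\<mu> \<noteq> 0" using w(2) by auto
  then have N: "N *v w = inverse \<mu> *s w" using wN
    by (metis left_inverse vec.scale_one vec.scale_scale)
  have pow_eig: "(((*v) R) ^^ k) w = \<nu> ^ k *s w" if "R *v w = \<nu> *s w" for R \<nu> k
    using that by (induction k) (simp_all add: vec.scale mult.commute)
  \<comment> \<open>A modulus above one would make the norms of the multiples of \<open>w\<close>
    grow geometrically past \<open>L\<close>.\<close>
  have bound: "cmod \<nu> \<le> 1" if "\<And>k. norm (\<nu> ^ k *s w) \<le> L" for \<nu>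
  proof (rule ccontr)
    assume "\<not> cmod \<nu> \<le> 1"
    then obtain k where k: "L / norm w < cmod \<nu> ^ k" using real_arch_pow[of "cmod \<nu>" "L / norm w"] by auto
    have "cmod \<nu> ^ k * norm w \<le> L" using that[of k] by (simp add: norm_scale norm_power)
    then show False using k w(2) by (simp add: field_simps)
  qed
  \<comment> \<open>The forward orbit bounds \<open>\<mu>\<close>, the backward orbit bounds its
    inverse.\<close>
  have "cmod \<mu> \<le> 1" using L pow_eig[OF w(3)] by (intro bound) (simp add: bdd_def)
  moreover have "cmod (inverse \<mu>) \<le> 1" using L pow_eig[OF N] by (intro bound) (simp add: bdd_def)
  then have "cmod \<mu> \<ge> 1" using \<open>\<mu> \<noteq> 0\<close>
    by (metis inverse_le_1_iff norm_inverse not_less zero_less_norm_iff)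
  ultimately have "cmod \<mu> = 1" by simp
  moreover have "\<mu> \<in> mat_spectrum M" using w unfolding mat_spectrum_def by blast
  ultimately show False using hyp by blast
qed

section \<open>Lifts of torus maps\<close>

abbreviation real_mat :: "int ^ 'n ^ 'm \<Rightarrow> real ^ 'n ^ 'm" where
  "real_mat \<equiv> map_matrix of_int"

lemma real_mat_mult: "real_mat (A ** B) = real_mat A ** real_mat B"
  by (simp add: vec_eq_iff matrix_matrix_mult_def)

lemma real_mat_one: "real_mat (mat 1) = mat 1"
  by (simp add: vec_eq_iff mat_def)

section \<open>Integer matrices as maps of the torus\<close>

lemma torus_aut_proj: "torus_aut A (torus_proj x) = torus_proj (real_mat A *v x)"
  by transfer (simp add: lattice_rel_def)

lemma torus_proj_add_lattice: "(\<And>i. m $ i \<in> \<int>) \<Longrightarrow> torus_proj (x + m) = torus_proj x"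
  by (simp add: torus_proj_eq_iff lattice_rel_def)

lemma torus_aut_mult: "torus_aut (A ** B) = torus_aut A \<circ> torus_aut B"
proof
  fix \<theta> :: "'a torus"
  obtain x where "torus_proj x = \<theta>" using torus_proj_surj by blast
  then show "torus_aut (A ** B) \<theta> = (torus_aut A \<circ> torus_aut B) \<theta>"
    by (auto simp: torus_aut_proj real_mat_mult matrix_vector_mul_assoc)
qed

lemma torus_aut_one: "torus_aut (mat 1) = id"
proof
  fix \<theta> :: "'a torus"
  obtain x where "torus_proj x = \<theta>" using torus_proj_surj by blast
  then show "torus_aut (mat 1) \<theta> = id \<theta>"
    by (auto simp: torus_aut_proj real_mat_one)
qed

lemma torus_aut_zero: "torus_aut A (torus_proj 0) = torus_proj 0"
  by (simp add: torus_aut_proj)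

text \<open>If two entries in position \<open>i\<close>, \<open>j\<close> differ by
  \<open>d\<close>, the point with \<open>j\<close>-th coordinate \<open>1 / (2 * d)\<close> and all
  others zero has images whose \<open>i\<close>-th coordinates differ by \<open>1 / 2\<close>, which
  is not an integer.\<close>

lemma inj_torus_aut: "inj torus_aut"
proof (rule injI)
  fix A B :: "int ^ 'n ^ 'n"
  assume eq: "torus_aut A = torus_aut B"
  show "A = B"
  proof (rule ccontr)
    assume "A \<noteq> B"
    then obtain i j where ij: "A $ i $ j \<noteq> B $ i $ j" by (auto simp: vec_eq_iff)
    define d where "d = A $ i $ j - B $ i $ j"
    define x :: "real ^ 'n" where "x = axis j (1 / (2 * of_int d))"
    have comp: "(real_mat M *v x) $ i = of_int (M $ i $ j) / (2 * of_int d)" for M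
      by (simp add: x_def axis_def matrix_vector_mult_def if_distrib cong: if_cong)
    have "torus_proj (real_mat A *v x) = torus_proj (real_mat B *v x)"
      by (metis eq torus_aut_proj)
    then have "(real_mat A *v x) $ i - (real_mat B *v x) $ i \<in> \<int>"
      by (simp add: torus_proj_eq_iff lattice_rel_def)
    moreover have "(real_mat A *v x) $ i - (real_mat B *v x) $ i = of_int d / (2 * of_int d)"
      unfolding comp by (simp add: d_def diff_divide_distrib)
    then have "(real_mat A *v x) $ i - (real_mat B *v x) $ i = 1 / 2"
      using ij by (simp add: d_def)
    ultimately have "(1 / 2 :: real) \<in> \<int>" by simp
    then show False using Ints_nonzero_abs_ge1[of "1 / 2 :: real"] by simp
  qed
qed

section \<open>Continuity and lifting through the covering projection\<close>

lemma continuous_on_torus_proj: "continuous_on UNIV (torus_proj :: real ^ 'n \<Rightarrow> 'n torus)"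
  unfolding continuous_on_iff using dist_torus_le le_less_trans by blast

text \<open>Close points of the torus have close lifts, and a lattice translation moves the pair so
  that one of the lifts is the prescribed \<open>x\<close>.\<close>

lemma continuous_on_torusI:
  fixes \<phi> :: "'n::finite torus \<Rightarrow> 'a::metric_space"
  assumes "continuous_on UNIV (\<lambda>x. \<phi> (torus_proj x))"
  shows "continuous_on UNIV \<phi>"
  unfolding continuous_on_iff
proof (intro ballI allI impI)
  fix \<theta> :: "'n torus" and e :: real assume "e > 0"
  obtain x where x: "torus_proj x = \<theta>" using torus_proj_surj by blast
  obtain d where d: "d > 0" "\<And>y. dist y x < d \<Longrightarrow> dist (\<phi> (torus_proj y)) (\<phi> \<theta>) < e"
    using assms \<open>e > 0\<close> x unfolding continuous_on_iff by (metis UNIV_I)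
  have "dist (\<phi> \<theta>') (\<phi> \<theta>) < e" if less: "dist \<theta>' \<theta> < d" for \<theta>'
  proof -
    obtain y z where yz: "torus_proj y = \<theta>'" "torus_proj z = \<theta>" "dist y z < d"
      by (rule dist_torus_less[OF less])
    have "torus_proj (y + (x - z)) = \<theta>'" using lattice_rel_shift[of x z y] yz x by simp
    moreover have "dist (y + (x - z)) x < d" using yz by (simp add: dist_norm algebra_simps)
    ultimately show ?thesis using d by metis
  qed
  then show "\<exists>d>0. \<forall>\<theta>'\<in>UNIV. dist \<theta>' \<theta> < d \<longrightarrow> dist (\<phi> \<theta>') (\<phi> \<theta>) < e" using d(1) by blast
qed

text \<open>The \<open>j\<close>-th coordinate character into the unit circle. The chosen
  representative does not matter, as \<open>torus_char_proj\<close> shows; jointly the characters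
  separate points.\<close>

definition torus_char :: "'n::finite \<Rightarrow> 'n torus \<Rightarrow> complex" where
  "torus_char j \<theta> = cis (2 * pi * rep_torus \<theta> $ j)"

lemma cis_2pi_eq_iff: "cis (2 * pi * a) = cis (2 * pi * b) \<longleftrightarrow> a - b \<in> \<int>"
proof -
  have "cis (2 * pi * a) = cis (2 * pi * b) \<longleftrightarrow> cis (2 * pi * (a - b)) = 1"
    by (simp add: right_diff_distrib cis_divide[symmetric])
  also have "\<dots> \<longleftrightarrow> exp (\<i> * of_real (2 * pi * (a - b))) = 1"
    by (simp add: cis_conv_exp)
  also have "\<dots> \<longleftrightarrow> (\<exists>n::int. 2 * pi * (a - b) = of_int (2 * n) * pi)"
    unfolding exp_eq_1 by simp
  also have "\<dots> \<longleftrightarrow> (\<exists>n::int. (2 * pi) * (a - b) = (2 * pi) * of_int n)"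
    by (simp add: mult_ac)
  also have "\<dots> \<longleftrightarrow> (\<exists>n::int. a - b = of_int n)"
    by (subst mult_cancel_left) simp
  also have "\<dots> \<longleftrightarrow> a - b \<in> \<int>" by (auto simp: Ints_def)
  finally show ?thesis .
qed

lemma torus_proj_rep: "torus_proj (rep_torus \<theta>) = \<theta>"
  by (metis Quotient3_abs_rep Quotient3_torus torus_proj.abs_eq)

lemma torus_char_proj: "torus_char j (torus_proj x) = cis (2 * pi * x $ j)"
  unfolding torus_char_def cis_2pi_eq_iff
  using torus_proj_rep[of "torus_proj x"] by (simp add: torus_proj_eq_iff lattice_rel_def)

lemma torus_eqI: "(\<And>j. torus_char j \<theta> = torus_char j \<theta>') \<Longrightarrow> \<theta> = \<theta>'"
  unfolding torus_char_def cis_2pi_eq_iff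
  by (metis torus_proj_rep torus_proj_eq_iff lattice_rel_def)

lemma continuous_on_torus_char: "continuous_on UNIV (torus_char j)"
  by (rule continuous_on_torusI) (auto simp: torus_char_proj cis_conv_exp intro!: continuous_intros)

text \<open>The characters have continuous logarithms along the simply connected cover, which
  replaces covering space theory.\<close>

lemma torus_map_lift:
  fixes \<phi> :: "'n::finite torus \<Rightarrow> 'n torus"
  assumes "continuous_on UNIV \<phi>"
  obtains G where "continuous_on UNIV G" "\<And>x. torus_proj (G x) = \<phi> (torus_proj x)"
proof -
  have cont: "continuous_on UNIV (\<lambda>x. torus_char j (\<phi> (torus_proj x)))" for j
    by (intro continuous_on_compose2[OF continuous_on_torus_char]
        continuous_on_compose2[OF assms] continuous_on_torus_proj subset_UNIV)
  have "\<exists>g. continuous_on UNIV g \<and> (\<forall>x. torus_char j (\<phi> (torus_proj x)) = exp (g x))" for j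
    by (rule continuous_logarithm_on_contractible[OF cont[of j]])
      (auto simp: torus_char_def contractible_UNIV)
  then obtain g where g: "\<And>j. continuous_on UNIV (g j)"
      "\<And>j x. torus_char j (\<phi> (torus_proj x)) = exp (g j x)"
    by metis
  define G where "G x = (\<chi> j. Im (g j x) / (2 * pi))" for x
  have "continuous_on UNIV G" unfolding G_def by (intro continuous_intros g) simp
  moreover have "torus_proj (G x) = \<phi> (torus_proj x)" for x
  proof (rule torus_eqI)
    fix j
    \<comment> \<open>Characters have modulus one, so the logarithm is purely imaginary and its
      imaginary part over \<open>2 * pi\<close> is a coordinate of the lift.\<close>
    have "norm (exp (g j x)) = 1"
      unfolding g(2)[symmetric] by (simp add: torus_char_def)
    then have "Re (g j x) = 0" by simp
    then have "exp (g j x) = cis (Im (g j x))" by (simp add: exp_eq_polar)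
    then show "torus_char j (torus_proj (G x)) = torus_char j (\<phi> (torus_proj x))"
      by (simp add: g(2) torus_char_proj G_def)
  qed
  ultimately show thesis by (rule that)
qed

text \<open>Distinct integers are at least one apart, so each coordinate is a continuous function
  with discrete range on a connected space.\<close>

lemma continuous_lattice_valued_const:
  fixes H :: "real ^ 'n \<Rightarrow> real ^ 'm"
  assumes cont: "continuous_on UNIV H" and int: "\<And>x i. H x $ i \<in> \<int>"
  shows "H x = H y"
proof (rule vec_eq_iff[THEN iffD2], rule allI)
  fix i
  have "(\<lambda>x. H x $ i) constant_on UNIV"
  proof (rule continuous_discrete_range_constant)
    fix x
    have "1 \<le> norm (H y $ i - H x $ i)" if "H y $ i \<noteq> H x $ i" for y
      using Ints_nonzero_abs_ge1[of "H y $ i - H x $ i"] that int by simp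
    then show "\<exists>e>0. \<forall>y. y \<in> UNIV \<and> H y $ i \<noteq> H x $ i \<longrightarrow> e \<le> norm (H y $ i - H x $ i)"
      by (intro exI[of _ 1]) auto
  qed (auto intro!: continuous_intros cont)
  then show "H x $ i = H y $ i" unfolding constant_on_def by fastforce
qed

text \<open>Reduces periodicity under the lattice to the unit vectors: first natural multiples, then
  integer multiples, then sums over the coordinates.\<close>

lemma lattice_vec_induct:
  fixes Q :: "real ^ 'n \<Rightarrow> 'a"
  assumes unit: "\<And>x j. Q (x + axis j 1) = Q x" and m: "\<And>i. m $ i \<in> \<int>"
  shows "Q (x + m) = Q x"
proof -
  have nat: "Q (x + of_nat k *\<^sub>R axis j 1) = Q x" for x j k
  proof (induction k)
    case (Suc k)
    then show ?case using unit[of "x + of_nat k *\<^sub>R axis j 1" j]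
      by (simp add: scaleR_add_left add_ac)
  qed simp
  have int: "Q (x + of_int k *\<^sub>R axis j 1) = Q x" for x j k
  proof (cases k)
    case (nonneg n)
    then show ?thesis using nat by simp
  next
    case (neg n)
    \<comment> \<open>For a negative multiple, start at the translated point and walk back to
      \<open>x\<close>.\<close>
    then show ?thesis using nat[of "x + of_int k *\<^sub>R axis j 1" "Suc n" j] 
      by (simp flip: scaleR_add_left add: add.assoc)
  qed
  have fin: "Q (x + (\<Sum>j\<in>S. (m $ j) *\<^sub>R axis j 1)) = Q x" for x S
  proof (induction S rule: infinite_finite_induct)
    case (insert j S)
    obtain k where k: "m $ j = of_int k" using m[of j] by (elim Ints_cases)
    show ?case
      using insert int[of "x + (\<Sum>j\<in>S. (m $ j) *\<^sub>R axis j 1)" k j] k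
      by (simp add: algebra_simps)
  qed auto
  have "m = (\<Sum>j\<in>UNIV. (m $ j) *\<^sub>R axis j 1)"
    by (simp add: vec_eq_iff axis_def if_distrib cong: if_cong)
  then show ?thesis using fin[of x UNIV] by simp
qed

text \<open>Subtracting the floors of the coordinates moves any point into the unit cube, which is
  compact.\<close>

lemma lattice_periodic_bounded:
  fixes Q :: "real ^ 'n \<Rightarrow> real ^ 'm"
  assumes cont: "continuous_on UNIV Q" and per: "\<And>x m. (\<And>i. m $ i \<in> \<int>) \<Longrightarrow> Q (x + m) = Q x"
  obtains K where "\<And>x. norm (Q x) \<le> K"
proof -
  have "compact (Q ` cbox 0 1)"
    by (intro compact_continuous_image compact_cbox continuous_on_subset[OF cont]) simp
  then obtain K where K: "\<And>y. y \<in> Q ` cbox 0 1 \<Longrightarrow> norm y \<le> K"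
    by (meson bounded_iff compact_imp_bounded)
  have "norm (Q x) \<le> K" for x
  proof -
    define m where "m = (\<chi> i. real_of_int \<lfloor>x $ i\<rfloor>)"
    have "x - m \<in> cbox 0 1"
      unfolding mem_box_cart m_def by (auto simp: frac_lt_1 less_imp_le simp flip: frac_def)
    moreover have "Q (x - m + m) = Q (x - m)" by (rule per) (simp add: m_def)
    ultimately show ?thesis using K by simp
  qed
  then show thesis by (rule that)
qed

section \<open>Rigidity of hyperbolic automorphisms\<close>

definition complex_vec :: "real ^ 'n \<Rightarrow> complex ^ 'n" where
  "complex_vec v = (\<chi> i. of_real (v $ i))"

lemma norm_complex_vec: "norm (complex_vec v) = norm v"
  by (simp add: complex_vec_def norm_vec_def)

lemma complex_vec_eq_0_iff [simp]: "complex_vec v = 0 \<longleftrightarrow> v = 0"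
  by (simp add: complex_vec_def vec_eq_iff)

lemma complex_vec_mult: "complex_vec (real_mat A *v v) = map_matrix of_int A *v complex_vec v"
  by (simp add: complex_vec_def vec_eq_iff matrix_vector_mult_def)

text \<open>Complexification is isometric and commutes with integer matrices, so the complex
  statement, where eigenvectors are available, applies to real vectors.\<close>

lemma hyperbolic_funpow_bounded_imp_zero:
  fixes A N :: "int ^ 'n ^ 'n"
  assumes AN: "A ** N = mat 1" "N ** A = mat 1" and hyp: "hyperbolic A"
    and v: "\<And>k. norm ((((*v) (real_mat A)) ^^ k) v) \<le> K" "\<And>k. norm ((((*v) (real_mat N)) ^^ k) v) \<le> K"
  shows "v = 0"
proof -
  have mult: "map_matrix of_int (M ** L) = map_matrix of_int M ** (map_matrix of_int L :: complex ^ 'n ^ 'n)"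
    for M L :: "int ^ 'n ^ 'n" by (simp add: vec_eq_iff matrix_matrix_mult_def)
  have one: "map_matrix of_int (mat 1 :: int ^ 'n ^ 'n) = (mat 1 :: complex ^ 'n ^ 'n)"
    by (simp add: vec_eq_iff mat_def)
  have pow: "(((*v) (map_matrix of_int M)) ^^ k) (complex_vec v) = complex_vec ((((*v) (real_mat M)) ^^ k) v)"
    for M :: "int ^ 'n ^ 'n" and k
    by (induction k) (simp_all add: complex_vec_mult)
  have "complex_vec v = 0"
    by (rule matrix_funpow_bounded_imp_zero[where M = "map_matrix of_int A" and N = "map_matrix of_int N"])
      (use hyp v in \<open>auto simp: mult[symmetric] AN one hyperbolic_def pow norm_complex_vec\<close>)
  then show ?thesis by simp
qed

lemma GLZ_inverse:
  fixes A :: "int ^ 'n ^ 'n"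
  assumes "A \<in> carrier GLZ"
  obtains N where "N \<in> carrier GLZ" "A ** N = mat 1" "N ** A = mat 1"
proof -
  interpret group "GLZ :: (int ^ 'n ^ 'n) monoid" by (rule group_GLZ)
  show thesis
    using that[of "inv\<^bsub>GLZ\<^esub> A"] inv_closed[OF assms] r_inv[OF assms] l_inv[OF assms]
    by (simp add: GLZ_def)
qed

lemma lattice_vec_mult:
  fixes A :: "int ^ 'n ^ 'm" and m :: "real ^ 'n"
  assumes "\<And>i. m $ i \<in> \<int>"
  shows "(real_mat A *v m) $ i \<in> \<int>"
  using assms by (auto simp: matrix_vector_mult_def)

text \<open>The lift of a map commuting with \<open>A\<close> differs from its linear part by a bounded function
  \<open>Q\<close> with \<open>Q (A x) = A (Q x)\<close>; so each \<open>Q x\<close> has a bounded two-sided orbit under \<open>A\<close> and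
  vanishes.\<close>

lemma commuting_torus_map_linear:
  fixes A :: "int ^ 'n ^ 'n" and \<phi> :: "'n torus \<Rightarrow> 'n torus"
  assumes A: "A \<in> carrier GLZ" "hyperbolic A"
    and cont: "continuous_on UNIV \<phi>"
    and comm: "\<And>\<theta>. \<phi> (torus_aut A \<theta>) = torus_aut A (\<phi> \<theta>)"
    and zero: "\<phi> (torus_proj 0) = torus_proj 0"
  obtains B where "\<phi> = torus_aut B" "B ** A = A ** B"
proof -
  obtain N where N: "A ** N = mat 1" "N ** A = mat 1" using GLZ_inverse[OF A(1)] .
  obtain F where F: "continuous_on UNIV F" "\<And>x. torus_proj (F x) = \<phi> (torus_proj x)"
    using torus_map_lift[OF cont] by blast
  \<comment> \<open>Since the torus map fixes the class of zero, \<open>F 0\<close> is a lattice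
    vector; subtracting it normalises the lift to \<open>G 0 = 0\<close>.\<close>
  define G where "G x = F x - F 0" for x
  have F0: "F 0 $ i \<in> \<int>" for i
    using F(2)[of 0] zero by (simp add: torus_proj_eq_iff lattice_rel_def)
  have G0: "G 0 = 0" by (simp add: G_def)
  have contG: "continuous_on UNIV G" unfolding G_def by (intro continuous_intros F)
  have liftG: "torus_proj (G x) = \<phi> (torus_proj x)" for x
    using torus_proj_add_lattice[of "- F 0" "F x"] F0 F(2) by (simp add: G_def)
  have contG': "continuous_on UNIV (\<lambda>x. G (f x))" if "continuous_on UNIV f" for f :: "real ^ 'n \<Rightarrow> real ^ 'n"
    by (rule continuous_on_compose2[OF contG that]) simp
  have contM: "continuous_on UNIV (\<lambda>x. real_mat M *v f x)" if "continuous_on UNIV f"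
    for f :: "real ^ 'n \<Rightarrow> real ^ 'n" and M :: "int ^ 'n ^ 'n"
    by (rule continuous_on_compose2[OF linear_continuous_on that])
      (auto simp: linear_linear matrix_vector_mul_linear intro: linear_conv_bounded_linear[THEN iffD1])
  \<comment> \<open>For fixed \<open>m\<close> the difference \<open>G (x + m) - G x\<close> is
    continuous and lattice-valued, hence equal to its value at \<open>x = 0\<close>.\<close>
  have shift: "G (x + m) = G x + G m" if m: "\<And>i. m $ i \<in> \<int>" for x m
  proof -
    have "G (x + m) - G x = G (0 + m) - G 0"
    proof (rule continuous_lattice_valued_const[of "\<lambda>x. G (x + m) - G x"])
      show "continuous_on UNIV (\<lambda>x. G (x + m) - G x)" by (intro continuous_intros contG' contG)
      fix y i
      have "torus_proj (G (y + m)) = torus_proj (G y)"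
        using liftG torus_proj_add_lattice[OF m] by simp
      then show "(G (y + m) - G y) $ i \<in> \<int>" by (simp add: torus_proj_eq_iff lattice_rel_def)
    qed
    then show ?thesis using G0 by (simp add: algebra_simps)
  qed
  have G_int: "G m $ i \<in> \<int>" if "\<And>i. m $ i \<in> \<int>" for m i
  proof -
    have "torus_proj (G m) = torus_proj 0"
      using liftG[of m] torus_proj_add_lattice[of m 0] that zero by simp
    then show ?thesis by (simp add: torus_proj_eq_iff lattice_rel_def)
  qed
  \<comment> \<open>Both sides lift the same torus map, so they differ by a lattice-valued constant,
    and they agree at \<open>0\<close>.\<close>
  have GA: "G (real_mat A *v x) = real_mat A *v G x" for x
  proof -
    have "G (real_mat A *v x) - real_mat A *v G x = G (real_mat A *v 0) - real_mat A *v G 0"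
    proof (rule continuous_lattice_valued_const[of "\<lambda>x. G (real_mat A *v x) - real_mat A *v G x"])
      show "continuous_on UNIV (\<lambda>x. G (real_mat A *v x) - real_mat A *v G x)"
        by (intro continuous_intros contG' contM contG)
      fix y i
      have "torus_proj (G (real_mat A *v y)) = torus_proj (real_mat A *v G y)"
        using comm[of "torus_proj y"] by (simp add: liftG flip: torus_aut_proj)
      then show "(G (real_mat A *v y) - real_mat A *v G y) $ i \<in> \<int>"
        by (simp add: torus_proj_eq_iff lattice_rel_def)
    qed
    then show ?thesis by (simp add: G0)
  qed
  \<comment> \<open>The columns are the images of the unit vectors; these have integer entries, so
    the floor only changes the type.\<close>
  define B :: "int ^ 'n ^ 'n" where "B = (\<chi> i j. \<lfloor>G (axis j 1) $ i\<rfloor>)"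
  have axis_int: "(axis j 1 :: real ^ 'n) $ i \<in> \<int>" for i j by (simp add: axis_def)
  have B_axis: "real_mat B *v axis j 1 = G (axis j 1)" for j
    using G_int[OF axis_int] by (simp add: vec_eq_iff B_def matrix_vector_mult_basis column_def)
  define Q where "Q x = G x - real_mat B *v x" for x
  have Q_per: "Q (x + m) = Q x" if "\<And>i. m $ i \<in> \<int>" for x m
  proof (rule lattice_vec_induct[OF _ that])
    show "Q (x + axis j 1) = Q x" for x j
      using shift[OF axis_int, of x j] by (simp add: Q_def B_axis matrix_vector_right_distrib)
  qed
  have G_B: "G m = real_mat B *v m" if "\<And>i. m $ i \<in> \<int>" for m
    using Q_per[OF that, of 0] G0 by (simp add: Q_def)
  have BA: "B ** A = A ** B"
  proof -
    \<comment> \<open>Unit vectors and their images under \<open>A\<close> are lattice vectors,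
      where \<open>G\<close> and \<open>B\<close> agree, so the relation \<open>GA\<close> passes to
      the matrices.\<close>
    have "real_mat (B ** A) *v axis j 1 = real_mat (A ** B) *v axis j 1" for j
    proof -
      have "real_mat (B ** A) *v axis j 1 = G (real_mat A *v axis j 1)"
        using G_B[OF lattice_vec_mult[OF axis_int]]
        by (simp add: real_mat_mult matrix_vector_mul_assoc)
      also have "\<dots> = real_mat (A ** B) *v axis j 1"
        using G_B[OF axis_int] by (simp add: GA real_mat_mult matrix_vector_mul_assoc)
      finally show ?thesis .
    qed
    then show ?thesis
      by (simp add: vec_eq_iff matrix_vector_mult_basis column_def)
  qed
  have QA: "Q (real_mat A *v x) = real_mat A *v Q x" for x
  proof -
    have "real_mat B *v (real_mat A *v x) = real_mat A *v (real_mat B *v x)"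
      by (metis BA matrix_vector_mul_assoc real_mat_mult)
    then show ?thesis by (simp add: Q_def GA matrix_vector_mult_diff_distrib)
  qed
  have NA: "real_mat N *v (real_mat A *v x) = x" "real_mat A *v (real_mat N *v x) = x" for x
    by (simp_all add: matrix_vector_mul_assoc N real_mat_one flip: real_mat_mult)
  have QN: "Q (real_mat N *v x) = real_mat N *v Q x" for x
    by (metis NA QA)
  obtain K where K: "\<And>x. norm (Q x) \<le> K"
    by (rule lattice_periodic_bounded[OF _ Q_per])
      (auto simp: Q_def intro!: continuous_intros contG contM)
  \<comment> \<open>Iterates of \<open>Q x\<close> are again values of \<open>Q\<close>, so the
    single bound \<open>K\<close> serves every iterate in both directions.\<close>
  have pow: "(((*v) (real_mat M)) ^^ k) (Q x) = Q ((((*v) (real_mat M)) ^^ k) x)"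
    if "\<And>x. Q (real_mat M *v x) = real_mat M *v Q x" for M k x
    by (induction k) (simp_all add: that)
  have "Q x = 0" for x
    by (rule hyperbolic_funpow_bounded_imp_zero[OF N A(2), where K = K])
      (simp_all add: pow QA QN K)
  then have G_eq: "G x = real_mat B *v x" for x by (simp add: Q_def)
  have "\<phi> = torus_aut B"
  proof
    fix \<theta> :: "'n torus"
    obtain x where "torus_proj x = \<theta>" using torus_proj_surj by blast
    then show "\<phi> \<theta> = torus_aut B \<theta>" using liftG[of x] by (auto simp: G_eq torus_aut_proj)
  qed
  with BA show thesis by (rule that[rotated])
qed

text \<open>If \<open>A\<close> had finite order, all orbits would be finite and hence bounded in
  both directions, so every vector would vanish.\<close>

lemma hyperbolic_power_ne_one:
  fixes A :: "int ^ 'n ^ 'n"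
  assumes A: "A \<in> carrier GLZ" "hyperbolic A" and k: "k > 0"
  shows "A [^]\<^bsub>GLZ\<^esub> (k :: nat) \<noteq> \<one>\<^bsub>GLZ\<^esub>"
proof
  assume eq: "A [^]\<^bsub>GLZ\<^esub> k = \<one>\<^bsub>GLZ\<^esub>"
  obtain N where N: "A ** N = mat 1" "N ** A = mat 1" using GLZ_inverse[OF A(1)] .
  define f where "f = (*v) (real_mat A)"
  define g where "g = (*v) (real_mat N)"
  have pow: "(f ^^ n) x = real_mat (A [^]\<^bsub>GLZ\<^esub> n) *v x" for n x
    by (induction n arbitrary: x)
      (simp_all add: GLZ_def f_def real_mat_one real_mat_mult matrix_vector_mul_assoc funpow_Suc_right del: funpow.simps(2))
  have per: "(f ^^ k) x = x" for x
    using pow[of k x] eq by (simp add: GLZ_def real_mat_one)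
  have fg: "g (f x) = x" "f (g x) = x" for x
    by (simp_all add: f_def g_def matrix_vector_mul_assoc N real_mat_one flip: real_mat_mult)
  have mod: "(f ^^ n) x = (f ^^ (n mod k)) x" for n x
  proof -
    have "(f ^^ (k * j)) x = x" for j x by (induction j arbitrary: x) (simp_all add: funpow_add per)
    then show ?thesis by (metis comp_apply funpow_add mod_mult_div_eq)
  qed
  \<comment> \<open>As the \<open>k\<close>-th iterate of \<open>f\<close> is the identity,
    \<open>n\<close> backward steps equal \<open>k * n - n\<close> forward steps.\<close>
  have g_pow: "(g ^^ n) x \<in> (\<lambda>i. (f ^^ i) x) ` {..<k}" for n x
  proof -
    have "(g ^^ n) ((f ^^ n) x) = x" for n x
      by (induction n arbitrary: x) (simp_all add: fg funpow_Suc_right del: funpow.simps(2), simp add: fg flip: funpow_swap1)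
    then have cancel: "(g ^^ n) ((f ^^ n) y) = y" for y .
    have "(f ^^ n) ((f ^^ (k * n - n)) x) = (f ^^ (k * n)) x"
      using k by (simp flip: funpow_add comp_apply[of "f ^^ n"])
    also have "\<dots> = x" using mod[of "k * n" x] by simp
    finally have "(g ^^ n) x = (f ^^ (k * n - n)) x" using cancel by metis
    then have "(g ^^ n) x = (f ^^ ((k * n - n) mod k)) x" using mod by metis
    then show ?thesis using k by (metis imageI lessThan_iff mod_less_divisor)
  qed
  have f_pow: "(f ^^ n) x \<in> (\<lambda>i. (f ^^ i) x) ` {..<k}" for n x
    using k mod by (metis imageI lessThan_iff mod_less_divisor)
  have "x = 0" for x :: "real ^ 'n"
  proof -
    obtain K where "\<And>y. y \<in> (\<lambda>i. (f ^^ i) x) ` {..<k} \<Longrightarrow> norm y \<le> K"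
      by (meson finite_imageI finite_imp_bounded bounded_iff finite_lessThan)
    then show ?thesis
      using hyperbolic_funpow_bounded_imp_zero[OF N A(2), of x K] f_pow g_pow unfolding f_def g_def by blast
  qed
  from this[of "1"] show False by simp
qed

section \<open>Periodic orbits and centralizers\<close>

lemma torus_C1_has_deriv: "torus_C1 f \<Longrightarrow> has_torus_deriv f (torus_deriv f \<theta>) \<theta>"
  unfolding torus_C1_def by (metis torus_deriv_eq)

lemma torus_C1_funpow: "torus_C1 f \<Longrightarrow> torus_C1 (f ^^ k)"
  by (induction k) (simp_all add: torus_C1_id torus_C1_compose flip: id_def)

text \<open>\<open>M\<close> carries eigenvectors of \<open>D\<close> to eigenvectors of
  \<open>D'\<close>, and its left inverse keeps them nonzero.\<close>

lemma mat_spectrum_intertwined: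
  assumes "D' ** M = M ** D" "N ** M = mat 1"
  shows "mat_spectrum D \<subseteq> mat_spectrum D'"
proof
  fix \<mu> assume "\<mu> \<in> mat_spectrum D"
  then obtain v where v: "v \<noteq> 0" "D *v v = \<mu> *s v" unfolding mat_spectrum_def by blast
  have "N *v (M *v v) = v" by (simp add: matrix_vector_mul_assoc assms)
  then have "M *v v \<noteq> 0" using v by auto
  moreover have "D' *v (M *v v) = M *v (D *v v)" by (simp add: matrix_vector_mul_assoc assms)
  then have "D' *v (M *v v) = \<mu> *s (M *v v)" by (simp add: v vec.scale)
  ultimately show "\<mu> \<in> mat_spectrum D'" unfolding mat_spectrum_def by blast
qed

text \<open>The chain rule for the two sides of \<open>f \<circ> g = g \<circ> f\<close> at the
  fixed point shows that the derivative of \<open>g\<close> intertwines those of \<open>f\<close>.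
  The derivative of the inverse of \<open>g\<close> is the left inverse needed.\<close>

lemma mat_spectrum_commuting_subset:
  assumes g: "g \<in> Diff1" and f: "torus_C1 f" and comm: "f \<circ> g = g \<circ> f" and fix_pt: "f \<theta> = \<theta>"
  shows "mat_spectrum (map_matrix of_real (torus_deriv f \<theta>)) \<subseteq>
         mat_spectrum (map_matrix of_real (torus_deriv f (g \<theta>)))"
proof -
  define g' where "g' = inv_into UNIV g"
  have gC1: "torus_C1 g" "torus_C1 g'" and g'g: "g' \<circ> g = id"
    using g by (auto simp: Diff1_def g'_def bij_is_inj)
  define D D' M N where "D = torus_deriv f \<theta>" and "D' = torus_deriv f (g \<theta>)"
    and "M = torus_deriv g \<theta>" and "N = torus_deriv g' (g \<theta>)"
  have fg: "has_torus_deriv (f \<circ> g) (D' ** M) \<theta>"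
    unfolding D'_def M_def by (intro has_torus_deriv_compose torus_C1_has_deriv f gC1)
  have "has_torus_deriv (g \<circ> f) (torus_deriv g (f \<theta>) ** D) \<theta>"
    unfolding D_def by (intro has_torus_deriv_compose torus_C1_has_deriv f gC1)
  then have gf: "has_torus_deriv (f \<circ> g) (M ** D) \<theta>" by (simp add: fix_pt M_def comm)
  have DM: "D' ** M = M ** D" by (rule has_torus_deriv_unique[OF fg gf])
  have "has_torus_deriv id (N ** M) \<theta>"
    unfolding N_def M_def g'g[symmetric] by (intro has_torus_deriv_compose torus_C1_has_deriv gC1)
  moreover have "has_torus_deriv id (mat 1) \<theta>"
    unfolding has_torus_deriv_def
    by (intro exI[of _ "\<lambda>y. y"] exI[of _ "rep_torus \<theta>"]) (auto simp: torus_proj_rep intro!: derivative_eq_intros)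
  ultimately have NM: "N ** M = mat 1" by (rule has_torus_deriv_unique)
  have mult: "map_matrix complex_of_real (X ** Y) = map_matrix of_real X ** map_matrix of_real Y"
    for X Y :: "real ^ 'a ^ 'a"
    by (simp add: vec_eq_iff matrix_matrix_mult_def)
  have one: "map_matrix complex_of_real (mat 1 :: real ^ 'a ^ 'a) = mat 1"
    by (simp add: vec_eq_iff mat_def)
  show ?thesis unfolding D_def[symmetric] D'_def[symmetric]
    by (rule mat_spectrum_intertwined[where M = "map_matrix of_real M" and N = "map_matrix of_real N"])
      (simp_all add: DM NM one flip: mult)
qed

text \<open>The missing inclusion is the previous lemma for the inverse of \<open>g\<close> at the
  point \<open>g \<theta>\<close>.\<close>

lemma mat_spectrum_commuting:
  assumes g: "g \<in> Diff1" and f: "torus_C1 f" and comm: "f \<circ> g = g \<circ> f" and fix_pt: "f \<theta> = \<theta>"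
  shows "mat_spectrum (map_matrix of_real (torus_deriv f (g \<theta>))) =
         mat_spectrum (map_matrix of_real (torus_deriv f \<theta>))"
proof (rule antisym)
  define g' where "g' = inv_into UNIV g"
  have bij: "bij g" using g by (simp add: Diff1_def)
  have g': "g' \<in> Diff1" using g by (simp add: Diff1_def g'_def bij_imp_bij_inv inv_inv_eq)
  have gg': "g (g' x) = x" "g' (g x) = x" for x
    using bij by (simp_all add: g'_def bij_is_surj surj_f_inv_f bij_is_inj)
  have "f (g' x) = g' (f x)" for x using comm gg' by (metis comp_apply)
  then have "f \<circ> g' = g' \<circ> f" by auto
  moreover have "f (g \<theta>) = g \<theta>" using comm fix_pt by (metis comp_apply)
  ultimately show "mat_spectrum (map_matrix of_real (torus_deriv f (g \<theta>)))
      \<subseteq> mat_spectrum (map_matrix of_real (torus_deriv f \<theta>))"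
    using mat_spectrum_commuting_subset[OF g' f, of "g \<theta>"] by (simp add: gg')
qed (rule mat_spectrum_commuting_subset[OF assms])

section \<open>Group powers, iterates and periodic orbits\<close>

lemma Diff1_nat_pow: "f [^]\<^bsub>Diff1_group\<^esub> (k :: nat) = f ^^ k"
  by (induction k) (simp_all add: Diff1_group_def funpow_Suc_right id_def del: funpow.simps(2))

lemma Diff1_int_pow:
  assumes "f \<in> Diff1"
  shows "f [^]\<^bsub>Diff1_group\<^esub> (int k) = f ^^ k"
    and "(f [^]\<^bsub>Diff1_group\<^esub> (- int k)) \<circ> (f ^^ k) = id"
proof -
  interpret group "Diff1_group :: ('a torus \<Rightarrow> 'a torus) monoid" by (rule group_Diff1)
  have f: "f \<in> carrier Diff1_group" using assms by (simp add: Diff1_group_def)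
  show "f [^]\<^bsub>Diff1_group\<^esub> (int k) = f ^^ k" by (simp add: int_pow_int Diff1_nat_pow)
  have "f [^]\<^bsub>Diff1_group\<^esub> (- int k) \<otimes>\<^bsub>Diff1_group\<^esub> f [^]\<^bsub>Diff1_group\<^esub> k = \<one>\<^bsub>Diff1_group\<^esub>"
    using f by (simp add: int_pow_neg int_pow_int)
  then show "(f [^]\<^bsub>Diff1_group\<^esub> (- int k)) \<circ> (f ^^ k) = id"
    by (simp add: Diff1_nat_pow) (simp add: Diff1_group_def)
qed

lemma funpow_periodic: "(f ^^ p) \<theta> = \<theta> \<Longrightarrow> (f ^^ (p * k)) \<theta> = \<theta>"
  by (induction k) (simp_all add: funpow_add)

text \<open>On a periodic point \<open>p * n\<close> steps return to the start, so undoing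
  \<open>n\<close> steps is the same as making the remaining ones. This turns negative powers into
  forward iterates.\<close>

lemma left_inverse_funpow_periodic:
  assumes "u \<circ> (f ^^ n) = id" "(f ^^ p) \<theta> = \<theta>" "p > 0"
  shows "u \<theta> = (f ^^ (p * n - n)) \<theta>"
proof -
  have "(f ^^ n) ((f ^^ (p * n - n)) \<theta>) = \<theta>"
    using funpow_periodic[OF assms(2), of n] assms(3)
    by (simp add: Suc_leI funpow_add[THEN fun_cong, unfolded comp_apply, symmetric])
  then show ?thesis using assms(1) by (metis comp_apply id_apply)
qed

text \<open>\<open>g\<close> commutes with the \<open>p\<close>-th iterate of \<open>f\<close>, so
  it preserves both \<open>p\<close>-periodicity and the spectrum there; equal spectra leave only
  one possible orbit.\<close>

lemma centralizer_preserves_periodic_orbits: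
  assumes f: "f \<in> Diff1" and spectra: "distinct_periodic_spectra p f" and "p > 0"
    and g: "g \<in> centralizer Diff1_group f" and \<theta>: "\<theta> \<in> Per p f"
  shows "\<exists>m. g \<theta> = (f ^^ m) \<theta>"
proof -
  have gD: "g \<in> Diff1" and comm: "g \<circ> f = f \<circ> g"
    using g by (auto simp: centralizer_def Diff1_group_def)
  have fp: "(f ^^ p) \<theta> = \<theta>" using \<theta> by (simp add: Per_def)
  have gf: "g (f x) = f (g x)" for x using comm by (metis comp_apply)
  have "g ((f ^^ k) x) = (f ^^ k) (g x)" for k x
    by (induction k) (simp_all add: gf)
  then have comm': "(f ^^ p) \<circ> g = g \<circ> (f ^^ p)" by auto
  have "(f ^^ p) (g \<theta>) = g \<theta>" using fun_cong[OF comm', of \<theta>] fp by simp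
  then have g\<theta>: "g \<theta> \<in> Per p f" by (simp add: Per_def)
  have "torus_C1 (f ^^ p)" using f by (intro torus_C1_funpow) (simp add: Diff1_def)
  then have "torus_orbit f (g \<theta>) = torus_orbit f \<theta>"
    using mat_spectrum_commuting[OF gD _ comm' fp] spectra \<theta> g\<theta>
    unfolding distinct_periodic_spectra_def by metis
  moreover have "g \<theta> = (f [^]\<^bsub>Diff1_group\<^esub> (int 0)) (g \<theta>)"
    unfolding Diff1_int_pow(1)[OF f] by simp
  then have "g \<theta> \<in> torus_orbit f (g \<theta>)" unfolding torus_orbit_def by blast
  ultimately obtain k :: int where k: "g \<theta> = (f [^]\<^bsub>Diff1_group\<^esub> k) \<theta>"
    unfolding torus_orbit_def by blast
  show ?thesis
  proof (cases k)
    case (nonneg n)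
    then show ?thesis using k Diff1_int_pow(1)[OF f] by auto
  next
    case (neg n)
    then show ?thesis
      using k left_inverse_funpow_periodic[OF Diff1_int_pow(2)[OF f] fp \<open>p > 0\<close>] by metis
  qed
qed

text \<open>A fixed point of \<open>-1\<close> has a lift with \<open>2 * x\<close> integral, so
  each coordinate is \<open>0\<close> or \<open>1 / 2\<close> modulo one. Finiteness is what makes
  the later comparison of cardinalities legitimate.\<close>

lemma finite_Per_minus_one: "finite (Per 1 (torus_aut (- mat 1 :: int ^ 'n ^ 'n)))"
proof (rule finite_subset)
  show "Per 1 (torus_aut (- mat 1 :: int ^ 'n ^ 'n)) \<subseteq>
      range (\<lambda>S. torus_proj (\<chi> i. if i \<in> S then 1 / 2 else 0))"
  proof
    fix \<theta> assume \<theta>: "\<theta> \<in> Per 1 (torus_aut (- mat 1 :: int ^ 'n ^ 'n))"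
    obtain x where x: "torus_proj x = \<theta>" using torus_proj_surj by blast
    have "real_mat (- mat 1 :: int ^ 'n ^ 'n) = - mat 1" by (simp add: vec_eq_iff mat_def)
    moreover have "(- M) *v x = - (M *v x)" for M :: "real ^ 'n ^ 'n"
      by (simp add: vec_eq_iff matrix_vector_mult_def sum_negf)
    ultimately have "real_mat (- mat 1 :: int ^ 'n ^ 'n) *v x = - x" by simp
    moreover have "torus_aut (- mat 1 :: int ^ 'n ^ 'n) (torus_proj x) = torus_proj x"
      using \<theta> unfolding x Per_def by simp
    ultimately have "torus_proj x = torus_proj (- x)" by (simp only: torus_aut_proj)
    then have "\<exists>k::int. x $ i + x $ i = of_int k" for i
      by (simp add: torus_proj_eq_iff lattice_rel_def Ints_def image_iff)
    then obtain k :: "'n \<Rightarrow> int" where k: "\<And>i. x $ i + x $ i = of_int (k i)" by metis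
    have "x $ i - (if odd (k i) then 1 / 2 else 0) = of_int (k i div 2)" for i
    proof -
      have "k i = 2 * (k i div 2) + k i mod 2" by simp
      then have "real_of_int (k i) = 2 * of_int (k i div 2) + of_int (k i mod 2)"
        by (metis of_int_add of_int_mult of_int_numeral)
      moreover have "k i mod 2 = (if odd (k i) then 1 else 0)" by (simp add: mod2_eq_if)
      ultimately show ?thesis using k[of i] by (auto split: if_splits)
    qed
    then have "torus_proj x = torus_proj (\<chi> i. if i \<in> {i. odd (k i)} then 1 / 2 else 0)"
      by (simp add: torus_proj_eq_iff lattice_rel_def)
    then show "\<theta> \<in> range (\<lambda>S. torus_proj (\<chi> i. if i \<in> S then 1 / 2 else 0))"
      unfolding x by (rule range_eqI)
  qed
qed simp

text \<open>Write \<open>j = 2^a * u\<close> and \<open>s = 2^c * r\<close> with \<open>u\<close>,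
  \<open>r\<close> odd and \<open>b = c + 1\<close>. Nontriviality gives \<open>a \<le> c\<close>,
  and \<open>j * 2^(c - a) - s = 2^c * (u - r)\<close> is divisible by \<open>2^b\<close>, because a
  difference of odd numbers is even.\<close>

lemma (in group) involution_in_cyclic_2_group:
  assumes x: "x \<in> carrier G" "ord x = 2 ^ b"
    and j: "x [^] (j :: int) \<noteq> \<one>" and s: "x [^] (s :: int) \<noteq> \<one>" "x [^] (2 * s) = \<one>"
  obtains t :: nat where "(x [^] j) [^] t = x [^] s"
proof -
  have dvd: "x [^] i = \<one> \<longleftrightarrow> 2 ^ b dvd i" for i :: int
    using int_pow_eq_id[OF x(1), of i] x(2) by simp
  have nd: "\<not> 2 ^ b dvd j" "\<not> 2 ^ b dvd s" "2 ^ b dvd 2 * s" using j s dvd by auto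
  then have "b \<noteq> 0" by (metis one_dvd power_0)
  then obtain c where c: "b = Suc c" using not0_implies_Suc by blast
  obtain r where r: "s = 2 ^ c * r" using nd(3) c by (auto elim: dvdE)
  have "odd r" using nd(2) by (auto simp: r c elim!: evenE)
  have "j \<noteq> 0" using nd(1) by auto
  then obtain u where u: "j = 2 ^ multiplicity 2 j * u" "\<not> 2 dvd u"
    by (rule multiplicity_decompose'[where p = "2 :: int"]) auto
  define a where "a = multiplicity 2 j"
  have "a \<le> c"
  proof (rule ccontr)
    assume "\<not> a \<le> c"
    then have "(2 :: int) ^ b dvd 2 ^ a" by (intro le_imp_power_dvd) (simp add: c)
    then show False using nd(1) u(1) by (metis a_def dvd_mult2)
  qed
  then have "j * int (2 ^ (c - a)) = 2 ^ c * u"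
    using u(1) by (simp add: a_def[symmetric] mult_ac flip: power_add mult.assoc)
  then have "j * int (2 ^ (c - a)) - s = 2 ^ c * (u - r)" by (simp add: r right_diff_distrib)
  moreover have "2 dvd u - r" using u(2) \<open>odd r\<close> by simp
  ultimately have "2 ^ b dvd j * int (2 ^ (c - a)) - s" by (auto simp: c elim: evenE)
  then have "x [^] (j * int (2 ^ (c - a))) = x [^] s"
    using x by (simp add: int_pow_eq dvd_diff_commute)
  then have "(x [^] j) [^] (2 ^ (c - a) :: nat) = x [^] s"
    using x by (metis int_pow_int int_pow_pow)
  then show thesis by (rule that)
qed

section \<open>Powers of the automorphism and its centralizer\<close>

lemma torus_aut_nat_pow: "torus_aut (A [^]\<^bsub>GLZ\<^esub> (k :: nat)) = torus_aut A ^^ k"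
  by (induction k)
    (simp_all add: GLZ_def torus_aut_one torus_aut_mult funpow_Suc_right del: funpow.simps(2) flip: id_def)

lemma torus_aut_int_pow_neg:
  assumes "A \<in> carrier GLZ"
  shows "torus_aut (A [^]\<^bsub>GLZ\<^esub> (- int k)) \<circ> torus_aut A ^^ k = id"
proof -
  interpret group "GLZ :: (int ^ 'a ^ 'a) monoid" by (rule group_GLZ)
  have "A [^]\<^bsub>GLZ\<^esub> (- int k) \<otimes>\<^bsub>GLZ\<^esub> A [^]\<^bsub>GLZ\<^esub> k = \<one>\<^bsub>GLZ\<^esub>"
    using assms by (simp add: int_pow_neg int_pow_int)
  then have "A [^]\<^bsub>GLZ\<^esub> (- int k) ** A [^]\<^bsub>GLZ\<^esub> k = mat 1" by (simp add: GLZ_def)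
  then show ?thesis by (metis torus_aut_mult torus_aut_nat_pow torus_aut_one)
qed

lemma torus_aut_int_pow_periodic:
  assumes A: "A \<in> carrier GLZ" and "p > 0" and \<theta>: "\<theta> \<in> Per p (torus_aut A)"
  shows "\<exists>m. torus_aut (A [^]\<^bsub>GLZ\<^esub> (k :: int)) \<theta> = (torus_aut A ^^ m) \<theta>"
proof (cases k)
  case (nonneg n)
  then show ?thesis by (auto simp: int_pow_int torus_aut_nat_pow)
next
  case (neg n)
  have "(torus_aut A ^^ p) \<theta> = \<theta>" using \<theta> by (simp add: Per_def)
  then show ?thesis
    using left_inverse_funpow_periodic[OF torus_aut_int_pow_neg[OF A] _ \<open>p > 0\<close>] neg by metis
qed

lemma (in group) subgroup_centralizer:
  assumes x: "x \<in> carrier G"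
  shows "subgroup (centralizer G x) G"
proof (rule subgroupI)
  show "centralizer G x \<noteq> {}" using x by (auto simp: centralizer_def)
next
  fix a assume a: "a \<in> centralizer G x"
  then have aG: "a \<in> carrier G" by (simp add: centralizer_def)
  then have "inv a \<otimes> x = inv a \<otimes> (x \<otimes> a) \<otimes> inv a"
    using x by (simp add: m_assoc)
  also have "\<dots> = inv a \<otimes> (a \<otimes> x) \<otimes> inv a" using a by (simp add: centralizer_def)
  also have "\<dots> = x \<otimes> inv a"
    using aG x by (simp flip: m_assoc)
  finally show "inv a \<in> centralizer G x" using aG by (simp add: centralizer_def)
next
  fix a c assume a: "a \<in> centralizer G x" and c: "c \<in> centralizer G x"
  have "a \<otimes> c \<otimes> x = a \<otimes> (x \<otimes> c)" using a c x by (auto simp: centralizer_def m_assoc)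
  also have "\<dots> = (x \<otimes> a) \<otimes> c" using a c x by (auto simp: centralizer_def simp flip: m_assoc)
  finally show "a \<otimes> c \<in> centralizer G x" using a c x by (auto simp: centralizer_def m_assoc)
qed (auto simp: centralizer_def)

text \<open>Bezout gives naturals with \<open>a * x = p * y + 1\<close>. The
  \<open>m * a * x\<close>-th iterate fixes the point and differs from the \<open>m\<close>-th by a
  multiple of \<open>p\<close> steps, which may be dropped.\<close>

lemma funpow_eq_self_coprime:
  assumes a: "(f ^^ (m * a)) \<theta> = \<theta>" and p: "(f ^^ p) \<theta> = \<theta>" and cop: "coprime a p" "a \<noteq> 0"
  shows "(f ^^ m) \<theta> = \<theta>"
proof -
  obtain x y where xy: "a * x = p * y + 1" using coprime_bezout_strong[of a p] bezout_add_strong_nat[of a p] cop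
    by (metis coprime_common_divisor_nat)
  have "m * a * x = m * (p * y + 1)" by (simp only: mult.assoc xy)
  then have "m * a * x = m + p * (m * y)" by (simp add: algebra_simps)
  then have "\<theta> = (f ^^ (m + p * (m * y))) \<theta>" using funpow_periodic[OF a, of x] by simp
  also have "\<dots> = (f ^^ m) \<theta>" using funpow_periodic[OF p, of "m * y"] by (simp add: funpow_add)
  finally show ?thesis ..
qed

text \<open>The cyclic factor \<open>\<langle>J\<rangle>\<close> has even order only through \<open>-1\<close>: as \<open>A\<close> has infinite order, \<open>-1\<close>
  lies in \<open>\<langle>J\<rangle>\<close>, hence is its unique involution and a power of every nontrivial element of \<open>\<langle>J\<rangle>\<close>.\<close>

lemma orbit_preserving_centralizer_element:
  fixes A B J :: "int ^ 'n ^ 'n"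
  assumes A: "A \<in> carrier GLZ" "hyperbolic A"
    and J: "J \<in> centralizer GLZ A" "group.ord GLZ J = 2 ^ b"
    and C: "internal_direct_product (centralizer_group GLZ A)
              (generate (centralizer_group GLZ A) {A}) (generate (centralizer_group GLZ A) {J})"
    and p: "odd p"
    and count: "card (Per p (torus_aut A) - Per 1 (torus_aut A)) >
                card (Per 1 (torus_aut (- mat 1 :: int ^ 'n ^ 'n)))"
    and B: "B \<in> centralizer GLZ A"
    and orb: "\<And>\<theta>. \<theta> \<in> Per p (torus_aut A) \<Longrightarrow> \<exists>m. torus_aut B \<theta> = (torus_aut A ^^ m) \<theta>"
  obtains i :: int where "B = A [^]\<^bsub>GLZ\<^esub> i"
proof -
  interpret group "GLZ :: (int ^ 'n ^ 'n) monoid" by (rule group_GLZ)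
  let ?C = "centralizer_group GLZ A"
  let ?T = "torus_aut A"
  have mult: "X \<otimes>\<^bsub>GLZ\<^esub> Y = X ** Y" and one: "\<one>\<^bsub>GLZ\<^esub> = (mat 1 :: int ^ 'n ^ 'n)" for X Y :: "int ^ 'n ^ 'n"
    by (simp_all add: GLZ_def)
  have subC: "subgroup (centralizer GLZ A) GLZ" by (rule subgroup_centralizer[OF A(1)])
  interpret C: group ?C by (rule subgroup.subgroup_is_group[OF subC group_GLZ])
  have AC: "A \<in> centralizer GLZ A" using A(1) by (simp add: centralizer_def)
  have JG: "J \<in> carrier GLZ" using J(1) by (simp add: centralizer_def)
  have gen: "generate ?C {x} = {x [^]\<^bsub>GLZ\<^esub> (k :: int) | k. True}" if "x \<in> centralizer GLZ A" for x
    using C.generate_pow[of x] int_pow_consistent[OF subC that] that by auto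
  have decomp: "\<exists>i j. X = A [^]\<^bsub>GLZ\<^esub> (i :: int) \<otimes>\<^bsub>GLZ\<^esub> J [^]\<^bsub>GLZ\<^esub> (j :: int)"
    if "X \<in> centralizer GLZ A" for X
  proof -
    have "X \<in> generate ?C {A} <#>\<^bsub>?C\<^esub> generate ?C {J}"
      using C that unfolding internal_direct_product_def by simp
    then show ?thesis unfolding gen[OF AC] gen[OF J(1)] set_mult_def by auto
  qed
  have disj: "x = \<one>\<^bsub>GLZ\<^esub>" if "x = A [^]\<^bsub>GLZ\<^esub> (i :: int)" "x = J [^]\<^bsub>GLZ\<^esub> (j :: int)" for x i j
  proof -
    have "x \<in> generate ?C {A} \<inter> generate ?C {J}"
      unfolding gen[OF AC] gen[OF J(1)] using that by blast
    then show ?thesis using C unfolding internal_direct_product_def by simp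
  qed
  have A_inf: "i = 0" if "A [^]\<^bsub>GLZ\<^esub> (i :: int) = \<one>\<^bsub>GLZ\<^esub>" for i
  proof (rule ccontr)
    assume "i \<noteq> 0"
    \<comment> \<open>Order \<open>0\<close> encodes infinite order, so a nonzero \<open>i\<close>
      yields a positive order, which hyperbolicity excludes.\<close>
    have "int (ord A) dvd i" using that int_pow_eq_id[OF A(1)] by simp
    then have "ord A > 0" using \<open>i \<noteq> 0\<close> by (cases "ord A = 0") auto
    then show False using hyperbolic_power_ne_one[OF A] pow_ord_eq_1[OF A(1)] by blast
  qed
  \<comment> \<open>Centralizers are subgroups: \<open>A\<close> centralizes each power of
    \<open>J\<close>, hence so does every power of \<open>A\<close>.\<close>
  have comm: "A [^]\<^bsub>GLZ\<^esub> (i :: int) \<otimes>\<^bsub>GLZ\<^esub> J [^]\<^bsub>GLZ\<^esub> (j :: int) = J [^]\<^bsub>GLZ\<^esub> j \<otimes>\<^bsub>GLZ\<^esub> A [^]\<^bsub>GLZ\<^esub> i" for i j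
  proof -
    have "J [^]\<^bsub>GLZ\<^esub> j \<in> centralizer GLZ A"
      by (rule subgroup_int_pow_closed[OF subC J(1)])
    then have "A \<in> centralizer GLZ (J [^]\<^bsub>GLZ\<^esub> j)" using A(1) by (simp add: centralizer_def)
    moreover have sub: "subgroup (centralizer GLZ (J [^]\<^bsub>GLZ\<^esub> j)) GLZ"
      by (rule subgroup_centralizer) (simp add: JG)
    ultimately have "A [^]\<^bsub>GLZ\<^esub> i \<in> centralizer GLZ (J [^]\<^bsub>GLZ\<^esub> j)"
      using subgroup_int_pow_closed[OF sub] by blast
    then show ?thesis by (simp add: centralizer_def)
  qed
  obtain i j where ij: "B = A [^]\<^bsub>GLZ\<^esub> (i :: int) \<otimes>\<^bsub>GLZ\<^esub> J [^]\<^bsub>GLZ\<^esub> (j :: int)"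
    using decomp[OF B] by blast
  define D where "D = J [^]\<^bsub>GLZ\<^esub> j"
  have DG: "D \<in> carrier GLZ" by (simp add: D_def JG)
  have D_eq: "D = A [^]\<^bsub>GLZ\<^esub> (- i) \<otimes>\<^bsub>GLZ\<^esub> B"
    unfolding ij D_def[symmetric] using A(1) DG by (simp add: int_pow_neg flip: m_assoc)
  have "D \<otimes>\<^bsub>GLZ\<^esub> A = A \<otimes>\<^bsub>GLZ\<^esub> D" using comm[of 1 j] A(1) by (simp add: D_def int_pow_1)
  then have DA: "torus_aut D (?T x) = ?T (torus_aut D x)" for x
    by (metis comp_apply mult torus_aut_mult)
  then have DA_pow: "torus_aut D ((?T ^^ k) x) = (?T ^^ k) (torus_aut D x)" for k x
    by (induction k) simp_all
  have fixD: "torus_aut D \<theta> = \<theta>" if \<theta>: "\<theta> \<in> Per p ?T" for \<theta>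
  proof -
    have per: "(?T ^^ p) \<theta> = \<theta>" using \<theta> by (simp add: Per_def)
    obtain m where m: "torus_aut B \<theta> = (?T ^^ m) \<theta>" using orb[OF \<theta>] by blast
    have "(?T ^^ p) ((?T ^^ m) \<theta>) = (?T ^^ m) \<theta>"
      by (metis per add.commute comp_apply funpow_add)
    then have "torus_aut B \<theta> \<in> Per p ?T" by (simp add: Per_def m)
    then obtain l where "torus_aut (A [^]\<^bsub>GLZ\<^esub> (- i)) (torus_aut B \<theta>) = (?T ^^ l) (torus_aut B \<theta>)"
      using torus_aut_int_pow_periodic[OF A(1) odd_pos[OF p]] by blast
    then have D\<theta>: "torus_aut D \<theta> = (?T ^^ (l + m)) \<theta>"
      by (simp add: D_eq mult torus_aut_mult m funpow_add)
    \<comment> \<open>Because \<open>D\<close> commutes with \<open>A\<close>, each application of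
      \<open>D\<close> adds the same \<open>l + m\<close> steps along the orbit.\<close>
    have "(torus_aut D ^^ k) \<theta> = (?T ^^ ((l + m) * k)) \<theta>" for k
    proof (induction k)
      case (Suc k)
      then show ?case by (simp add: DA_pow D\<theta> funpow_add add.commute[of "l + m"])
    qed simp
    moreover have "torus_aut D ^^ (2 ^ b) = id"
    proof -
      have "D [^]\<^bsub>GLZ\<^esub> (2 ^ b :: nat) = (J [^]\<^bsub>GLZ\<^esub> (2 ^ b :: nat)) [^]\<^bsub>GLZ\<^esub> j"
        unfolding D_def by (metis JG int_pow_int int_pow_pow mult.commute)
      also have "\<dots> = \<one>\<^bsub>GLZ\<^esub>" using pow_ord_eq_1[OF JG] J(2) by simp
      also have "\<dots> = mat 1" by (rule one)
      finally show ?thesis by (metis torus_aut_nat_pow torus_aut_one)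
    qed
    ultimately have "(?T ^^ ((l + m) * 2 ^ b)) \<theta> = \<theta>" by (metis id_apply)
    then have "(?T ^^ (l + m)) \<theta> = \<theta>"
      by (rule funpow_eq_self_coprime[OF _ per]) (use p in simp_all)
    then show ?thesis by (simp add: D\<theta>)
  qed
  have "D = \<one>\<^bsub>GLZ\<^esub>"
  proof (rule ccontr)
    assume D1: "D \<noteq> \<one>\<^bsub>GLZ\<^esub>"
    let ?m = "- mat 1 :: int ^ 'n ^ 'n"
    have mm: "?m ** X = - X" "X ** ?m = - X" for X :: "int ^ 'n ^ 'n"
      by (simp_all add: vec_eq_iff matrix_matrix_mult_def mat_def sum_negf if_distrib[of "\<lambda>a. a * _"] if_distrib[of "\<lambda>a. _ * a"] cong: if_cong)
    \<comment> \<open>An integer of square one is \<open>1\<close> or \<open>-1\<close>; the parity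
      of the dimension need not be known.\<close>
    have "det ?m * det ?m = 1" by (simp add: mm flip: det_mul)
    then have "?m \<in> carrier GLZ" using zmult_eq_1_iff by (auto simp: GLZ_def)
    then have mC: "?m \<in> centralizer GLZ A" by (simp add: centralizer_def mult mm)
    obtain r s where rs: "?m = A [^]\<^bsub>GLZ\<^esub> (r :: int) \<otimes>\<^bsub>GLZ\<^esub> J [^]\<^bsub>GLZ\<^esub> (s :: int)"
      using decomp[OF mC] by blast
    have "\<one>\<^bsub>GLZ\<^esub> = ?m [^]\<^bsub>GLZ\<^esub> (2 :: int)"
      using int_pow_int[of GLZ ?m 2] by (simp add: numeral_2_eq_2 mult one mm)
    also have "\<dots> = (A [^]\<^bsub>GLZ\<^esub> r) [^]\<^bsub>GLZ\<^esub> (2 :: int) \<otimes>\<^bsub>GLZ\<^esub> (J [^]\<^bsub>GLZ\<^esub> s) [^]\<^bsub>GLZ\<^esub> (2 :: int)"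
      unfolding rs by (rule int_pow_mult_distrib[OF comm]) (simp_all add: A(1) JG)
    also have "\<dots> = A [^]\<^bsub>GLZ\<^esub> (r * 2) \<otimes>\<^bsub>GLZ\<^esub> J [^]\<^bsub>GLZ\<^esub> (s * 2)"
      by (simp add: int_pow_pow A(1) JG)
    finally have sq: "A [^]\<^bsub>GLZ\<^esub> (r * 2) \<otimes>\<^bsub>GLZ\<^esub> J [^]\<^bsub>GLZ\<^esub> (s * 2) = \<one>\<^bsub>GLZ\<^esub>" ..
    \<comment> \<open>The square of \<open>-1\<close> is trivial, so a power of \<open>A\<close>
      lies in both factors of the direct product and must be trivial; this forces
      \<open>r = 0\<close>.\<close>
    then have "A [^]\<^bsub>GLZ\<^esub> (r * 2) = J [^]\<^bsub>GLZ\<^esub> (- (s * 2))"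
      using A(1) JG by (simp add: int_pow_neg inv_equality)
    then have "A [^]\<^bsub>GLZ\<^esub> (r * 2) = \<one>\<^bsub>GLZ\<^esub>" using disj by blast
    then have "r = 0" using A_inf by fastforce
    then have m_J: "?m = J [^]\<^bsub>GLZ\<^esub> s" using rs JG by simp
    have "?m $ i $ i \<noteq> (mat 1 :: int ^ 'n ^ 'n) $ i $ i" for i by (simp add: mat_def)
    then have "J [^]\<^bsub>GLZ\<^esub> s \<noteq> \<one>\<^bsub>GLZ\<^esub>" using m_J by (metis one)
    moreover have "J [^]\<^bsub>GLZ\<^esub> (2 * s) = \<one>\<^bsub>GLZ\<^esub>" using sq JG \<open>r = 0\<close> by (simp add: mult.commute)
    ultimately obtain t :: nat where "D [^]\<^bsub>GLZ\<^esub> t = ?m"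
      using involution_in_cyclic_2_group[OF JG J(2)] D1 m_J unfolding D_def by metis
    then have m_D: "torus_aut ?m = torus_aut D ^^ t" by (metis torus_aut_nat_pow)
    have "(torus_aut D ^^ k) \<theta> = \<theta>" if "\<theta> \<in> Per p ?T" for k \<theta>
      by (induction k) (simp_all add: fixD that)
    then have "Per p ?T - Per 1 ?T \<subseteq> Per 1 (torus_aut ?m)" by (auto simp: Per_def m_D)
    then show False using card_mono[OF finite_Per_minus_one] count by (meson not_le)
  qed
  then have "B = A [^]\<^bsub>GLZ\<^esub> i" using ij A(1) by (simp add: D_def)
  then show thesis by (rule that)
qed

text \<open>The spectra pin down the orbit of \<open>g \<theta>\<close> for every periodic \<open>\<theta>\<close>; in particular \<open>g\<close> fixes the
  point \<open>h' 0\<close>, so that its conjugate is linear and not merely affine.\<close>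

lemma centralizer_conjugate_linear:
  fixes A :: "int ^ 'n ^ 'n" and h h' :: "'n torus \<Rightarrow> 'n torus"
  assumes A: "A \<in> carrier GLZ" "hyperbolic A"
    and h: "homeomorphism UNIV UNIV h h'" and conj: "h \<circ> f \<circ> h' = torus_aut A"
    and f: "f \<in> Diff1" "distinct_periodic_spectra p f" "p > 0"
    and g: "g \<in> centralizer Diff1_group f"
  obtains B where "h \<circ> g \<circ> h' = torus_aut B" "B ** A = A ** B"
    "\<And>\<theta>. \<theta> \<in> Per p (torus_aut A) \<Longrightarrow> \<exists>m. torus_aut B \<theta> = (torus_aut A ^^ m) \<theta>"
proof -
  have hh: "h (h' x) = x" "h' (h x) = x" for x
    using h by (simp_all add: homeomorphism_def)
  have hf: "h (f x) = torus_aut A (h x)" for x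
    using fun_cong[OF conj, of "h x"] hh by simp
  have hf_pow: "h ((f ^^ k) x) = (torus_aut A ^^ k) (h x)" for k x
    by (induction k) (simp_all add: hf)
  have gf: "g (f x) = f (g x)" for x
    using g by (simp add: centralizer_def Diff1_group_def fun_eq_iff)
  have gC1: "torus_C1 g" using g by (simp add: centralizer_def Diff1_group_def Diff1_def)
  have orb: "\<exists>m. (h \<circ> g \<circ> h') \<theta> = (torus_aut A ^^ m) \<theta>" if \<theta>: "\<theta> \<in> Per p (torus_aut A)" for \<theta>
  proof -
    have "h ((f ^^ p) (h' \<theta>)) = \<theta>" using \<theta> by (simp add: hf_pow hh Per_def)
    then have "h' \<theta> \<in> Per p f" by (metis (mono_tags) Per_def hh(2) mem_Collect_eq)
    then obtain m where "g (h' \<theta>) = (f ^^ m) (h' \<theta>)"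
      using centralizer_preserves_periodic_orbits[OF f g] by blast
    then show ?thesis by (auto simp: hf_pow hh)
  qed
  have zero_pow: "(torus_aut A ^^ m) (torus_proj 0) = torus_proj 0" for m
    by (induction m) (simp_all add: torus_aut_zero)
  have cont: "continuous_on UNIV (h \<circ> g \<circ> h')"
  proof (intro continuous_on_compose)
    show "continuous_on UNIV h'" using h by (simp add: homeomorphism_def)
    have "continuous_on UNIV g"
      using torus_C1_has_deriv[OF gC1] has_torus_deriv_continuous continuous_at_imp_continuous_on by blast
    then show "continuous_on (h' ` UNIV) g" by (rule continuous_on_subset) simp
    have "continuous_on UNIV h" using h by (simp add: homeomorphism_def)
    then show "continuous_on (g ` h' ` UNIV) h" by (rule continuous_on_subset) simp
  qed
  have comm: "(h \<circ> g \<circ> h') (torus_aut A \<theta>) = torus_aut A ((h \<circ> g \<circ> h') \<theta>)" for \<theta>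
  proof -
    have "h' (torus_aut A \<theta>) = f (h' \<theta>)" by (metis hf hh)
    then show ?thesis by (simp add: gf hf)
  qed
  have "torus_proj 0 \<in> Per p (torus_aut A)" by (simp add: Per_def zero_pow)
  then have zero: "(h \<circ> g \<circ> h') (torus_proj 0) = torus_proj 0" using orb zero_pow by metis
  obtain B where "h \<circ> g \<circ> h' = torus_aut B" "B ** A = A ** B"
    by (rule commuting_torus_map_linear[OF A cont comm zero])
  then show thesis using orb that by metis
qed

theorem theorem5p5:
  fixes A J :: "int ^ 'n ^ 'n"
    and b p :: nat
    and U Up :: "('n torus \<Rightarrow> 'n torus) set"
    and h :: "('n torus \<Rightarrow> 'n torus) \<Rightarrow> 'n torus \<Rightarrow> 'n torus"
    and e :: real
  assumes A: "A \<in> carrier GLZ" "hyperbolic A"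
    and U: "openin C1_topology U" "torus_aut A \<in> U"
    and U_anosov: "\<forall>f\<in>U. anosov f"
    and h_conj: "\<forall>f\<in>U. \<exists>h'. homeomorphism UNIV UNIV (h f) h' \<and> h f \<circ> f \<circ> h' = torus_aut A"
    and h_close: "\<forall>f\<in>U. \<forall>\<theta>. dist (h f \<theta>) \<theta> < e"
    and Up: "openin C1_topology Up" "Up \<noteq> {}" "Up \<subseteq> U - {torus_aut A}"
    and Up_spectra: "\<forall>f\<in>Up. distinct_periodic_spectra p f"
    and J: "J \<in> centralizer GLZ A" "group.ord GLZ J = 2 ^ b"
    and C: "internal_direct_product (centralizer_group GLZ A)
              (generate (centralizer_group GLZ A) {A}) (generate (centralizer_group GLZ A) {J})"
    and p: "prime p" "odd p"
    and count: "card (Per p (torus_aut A) - Per 1 (torus_aut A)) >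
                card (Per 1 (torus_aut (- mat 1 :: int ^ 'n ^ 'n)))"
  shows "\<forall>f\<in>Up. centralizer Diff1_group f = {f [^]\<^bsub>Diff1_group\<^esub> k | k :: int. True}"
proof
  fix f assume "f \<in> Up"
  then have "f \<in> U" and spectra: "distinct_periodic_spectra p f" using Up Up_spectra by auto
  then have f: "f \<in> Diff1" using U_anosov by (simp add: anosov_def)
  obtain h' where h': "homeomorphism UNIV UNIV (h f) h'" "h f \<circ> f \<circ> h' = torus_aut A"
    using h_conj \<open>f \<in> U\<close> by blast
  interpret D: group "Diff1_group :: ('n torus \<Rightarrow> 'n torus) monoid" by (rule group_Diff1)
  have fG: "f \<in> carrier Diff1_group" using f by (simp add: Diff1_group_def)
  have sub: "subgroup (centralizer Diff1_group f) Diff1_group"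
    by (rule D.subgroup_centralizer[OF fG])
  have fC: "f \<in> centralizer Diff1_group f" using fG by (simp add: centralizer_def)
  have hh: "h f (h' x) = x" "h' (h f x) = x" for x
    using h'(1) by (simp_all add: homeomorphism_def)
  have hf: "h f (f x) = torus_aut A (h f x)" for x
    using fun_cong[OF h'(2), of "h f x"] by (simp add: hh)
  have hf_pow: "h f ((f ^^ k) x) = (torus_aut A ^^ k) (h f x)" for k x
    by (induction k) (simp_all add: hf)
  have "\<exists>k :: int. g = f [^]\<^bsub>Diff1_group\<^esub> k" if g: "g \<in> centralizer Diff1_group f" for g
  proof -
    have gG: "g \<in> carrier Diff1_group" using g by (simp add: centralizer_def)
    \<comment> \<open>The inverse of \<open>g\<close> is linearised as well; its matrix is an
      inverse of \<open>B\<close>, which puts \<open>B\<close> into the integral linear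
      group.\<close>
    define g' where "g' = inv\<^bsub>Diff1_group\<^esub> g"
    have g': "g' \<in> centralizer Diff1_group f"
      unfolding g'_def by (rule subgroup.m_inv_closed[OF sub g])
    have "g \<otimes>\<^bsub>Diff1_group\<^esub> g' = \<one>\<^bsub>Diff1_group\<^esub>" using gG by (simp add: g'_def)
    then have gg': "g (g' x) = x" for x by (simp add: Diff1_group_def fun_eq_iff)
    note linear = centralizer_conjugate_linear[OF A h' f spectra prime_gt_0_nat[OF p(1)]]
    obtain B where B: "h f \<circ> g \<circ> h' = torus_aut B" "B ** A = A ** B"
      and orb: "\<And>\<theta>. \<theta> \<in> Per p (torus_aut A) \<Longrightarrow> \<exists>m. torus_aut B \<theta> = (torus_aut A ^^ m) \<theta>"
      using linear[OF g] by blast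
    obtain B' where B': "h f \<circ> g' \<circ> h' = torus_aut B'" using linear[OF g'] by blast
    have "torus_aut (B ** B') = torus_aut (mat 1)"
      unfolding torus_aut_mult torus_aut_one B(1)[symmetric] B'[symmetric]
      by (simp add: fun_eq_iff hh gg')
    then have "B ** B' = mat 1" by (rule injD[OF inj_torus_aut])
    then have "det B * det B' = 1" by (metis det_mul det_I)
    then have "B \<in> carrier GLZ" using zmult_eq_1_iff by (auto simp: GLZ_def)
    then have "B \<in> centralizer GLZ A" using B(2) by (simp add: centralizer_def GLZ_def)
    then obtain i :: int where i: "B = A [^]\<^bsub>GLZ\<^esub> i"
      using orbit_preserving_centralizer_element[OF A J C p(2) count _ orb] by blast
    have hg: "h f (g x) = torus_aut B (h f x)" for x
      using fun_cong[OF B(1), of "h f x"] by (simp add: hh)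
    show ?thesis
    proof (cases i rule: int_cases2)
      case (nonneg n)
      then have "h f (g x) = h f ((f ^^ n) x)" for x
        by (simp add: hg hf_pow i int_pow_int torus_aut_nat_pow)
      then have "g = f ^^ n" by (metis ext hh(2))
      then show ?thesis using Diff1_int_pow(1)[OF f] by metis
    next
      case (nonpos n)
      \<comment> \<open>For a nonpositive exponent, \<open>g\<close> is shown to cancel
        \<open>n\<close> steps of \<open>f\<close>, so that only forward iterates pass through the
        conjugacy.\<close>
      then have "h f (g ((f ^^ n) x)) = h f x" for x
        using fun_cong[OF torus_aut_int_pow_neg[OF A(1), of n], of "h f x"] by (simp add: hg hf_pow i)
      then have "g \<circ> (f ^^ n) = id" by (metis comp_apply eq_id_iff hh(2))
      then have "g \<otimes>\<^bsub>Diff1_group\<^esub> f [^]\<^bsub>Diff1_group\<^esub> n = \<one>\<^bsub>Diff1_group\<^esub>"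
        by (simp add: Diff1_nat_pow) (simp add: Diff1_group_def)
      then have "g = f [^]\<^bsub>Diff1_group\<^esub> (- int n)"
        using D.inv_equality[OF _ D.nat_pow_closed[OF fG] gG] fG by (simp add: D.int_pow_neg_int)
      then show ?thesis by blast
    qed
  qed
  moreover have "f [^]\<^bsub>Diff1_group\<^esub> (k :: int) \<in> centralizer Diff1_group f" for k
    by (rule D.subgroup_int_pow_closed[OF sub fC])
  ultimately show "centralizer Diff1_group f = {f [^]\<^bsub>Diff1_group\<^esub> k | k :: int. True}" by blast
qed

end
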